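(* Let $W_{\psi,\varphi}$ be an unbounded weighted composition operator on $\mathcal F^2$ induced by entire functions $\psi,\varphi$ with $\psi\not\equiv0$. Let $a,b,c\in\mathbb C$ satisfy $|a|=1$, $\bar ab+\bar b=0$, $|c|^2e^{|b|^2}=1$, and let $\mathcal C_{a,b,c}$ be the corresponding weighted composition conjugation. Then $W_{\psi,\varphi}$ is $\mathcal C_{a,b,c}$-selfadjoint if and only if the following two conditions hold. (1) $W_{\psi,\varphi}=W_{\psi,\varphi,\max}$. (2) There are complex constants $A,B,C,D$ with $C\neq0$ and $D=aB-bA+b$ such that $\varphi(z)=Az+B$ and $\psi(z)=Ce^{Dz}$.
   Context: The Fock space $\mathcal F^2$ is the Hilbert space of entire functions on $\mathbb C$ that are square integrable with respect to $\frac1\pi e^{-|z|^2}\,dV(z)$ ($dV$ is Lebesgue measure on $\mathbb C$), with inner product $\langle f,g\rangle=\frac1\pi\int_{\mathbb C}f(z)\overline{g(z)}e^{-|z|^2}\,dV(z)$. For entire functions $\psi,\varphi$, put $E(\psi,\varphi)f=\psi\cdot (f\circ\varphi)$. The maximal weighted composition operator $W_{\psi,\varphi,\max}$ has domain $\{f\in\mathcal F^2: E(\psi,\varphi)f\in\mathcal F^2\}$ and acts by $W_{\psi,\varphi,\max}f=E(\psi,\varphi)f$. An unbounded weighted composition operator $W_{\psi,\varphi}$ is the restriction of $W_{\psi,\varphi,\max}$ to some linear subspace $\operatorname{dom}(W_{\psi,\varphi})$ of $\operatorname{dom}(W_{\psi,\varphi,\max})$ ("unbounded" means not necessarily bounded).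 For $a,b,c$ as in the claim, the weighted composition conjugation is $\mathcal C_{a,b,c}f(z)=ce^{bz}\overline{f(\overline{az+b})}$, $f\in\mathcal F^2$; it is an anti-linear, isometric, involutive map on $\mathcal F^2$ (a conjugation). For a conjugation $\mathcal C$, $\operatorname{dom}(\mathcal CF\mathcal C)=\{f:\mathcal Cf\in\operatorname{dom}(F)\}$, and an operator $T$ is $\mathcal C$-selfadjoint if it is closed, densely defined, linear and $T=\mathcal CT^*\mathcal C$. *)

theory Defs
  imports "HOL-Analysis.Analysis"
begin

type_synonym cfun = "complex \<Rightarrow> complex"

definition fock :: "cfun set" where
  "fock = {f. f holomorphic_on UNIV \<and>
     integrable lborel (\<lambda>z. (cmod (f z))\<^sup>2 * exp (- (cmod z)\<^sup>2))}"

definition fock_inner :: "cfun \<Rightarrow> cfun \<Rightarrow> complex" where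
  "fock_inner f g = complex_of_real (1 / pi) *
     (LINT z|lborel. f z * cnj (g z) * complex_of_real (exp (- (cmod z)\<^sup>2)))"

definition fock_norm :: "cfun \<Rightarrow> real" where
  "fock_norm f = sqrt (Re (fock_inner f f))"

definition fock_subspace :: "cfun set \<Rightarrow> bool" where
  "fock_subspace V \<longleftrightarrow> V \<subseteq> fock \<and> (\<lambda>_. 0) \<in> V \<and>
     (\<forall>f\<in>V. \<forall>g\<in>V. (\<lambda>z. f z + g z) \<in> V) \<and>
     (\<forall>k. \<forall>f\<in>V. (\<lambda>z. k * f z) \<in> V)"

text \<open>A not necessarily bounded operator is a partial map: its domain is \<^const>\<open>dom\<close>,
  and equality of partial maps is equality of operators, domains included.\<close>

type_synonym fock_op = "cfun \<Rightarrow> cfun option"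

definition linear_op :: "fock_op \<Rightarrow> bool" where
  "linear_op T \<longleftrightarrow> fock_subspace (dom T) \<and> ran T \<subseteq> fock \<and>
     (\<forall>f\<in>dom T. \<forall>g\<in>dom T.
        the (T (\<lambda>z. f z + g z)) = (\<lambda>z. the (T f) z + the (T g) z)) \<and>
     (\<forall>k. \<forall>f\<in>dom T. the (T (\<lambda>z. k * f z)) = (\<lambda>z. k * the (T f) z))"

definition densely_defined :: "fock_op \<Rightarrow> bool" where
  "densely_defined T \<longleftrightarrow>
     (\<forall>f\<in>fock. \<forall>e>0. \<exists>g\<in>dom T. fock_norm (\<lambda>z. f z - g z) < e)"

definition closed_op :: "fock_op \<Rightarrow> bool" where
  "closed_op T \<longleftrightarrow>
     (\<forall>X. \<forall>f\<in>fock. \<forall>g\<in>fock.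
        (\<forall>n::nat. X n \<in> dom T) \<and>
        (\<lambda>n. fock_norm (\<lambda>z. X n z - f z)) \<longlonglongrightarrow> 0 \<and>
        (\<lambda>n. fock_norm (\<lambda>z. the (T (X n)) z - g z)) \<longlonglongrightarrow> 0
        \<longrightarrow> T f = Some g)"

text \<open>The adjoint is only meaningful for densely defined \<open>T\<close>, where the
  representing element \<open>h\<close> is unique.\<close>

definition adjoint_op :: "fock_op \<Rightarrow> fock_op" where
  "adjoint_op T = (\<lambda>g.
     if g \<in> fock \<and> (\<exists>h\<in>fock. \<forall>f\<in>dom T. fock_inner (the (T f)) g = fock_inner f h)
     then Some (THE h. h \<in> fock \<and> (\<forall>f\<in>dom T. fock_inner (the (T f)) g = fock_inner f h))
     else None)"

definition conj_by :: "(cfun \<Rightarrow> cfun) \<Rightarrow> fock_op \<Rightarrow> fock_op" where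
  "conj_by J T = (\<lambda>f. if f \<in> fock then map_option J (T (J f)) else None)"

definition C_selfadjoint :: "(cfun \<Rightarrow> cfun) \<Rightarrow> fock_op \<Rightarrow> bool" where
  "C_selfadjoint J T \<longleftrightarrow>
     closed_op T \<and> densely_defined T \<and> linear_op T \<and> T = conj_by J (adjoint_op T)"

definition wcomp_expr :: "cfun \<Rightarrow> cfun \<Rightarrow> cfun \<Rightarrow> cfun" where
  "wcomp_expr \<psi> \<phi> f = (\<lambda>z. \<psi> z * f (\<phi> z))"

definition wcomp_max :: "cfun \<Rightarrow> cfun \<Rightarrow> fock_op" where
  "wcomp_max \<psi> \<phi> = (\<lambda>f.
     if f \<in> fock \<and> wcomp_expr \<psi> \<phi> f \<in> fock then Some (wcomp_expr \<psi> \<phi> f) else None)"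

definition wcomp_op :: "cfun \<Rightarrow> cfun \<Rightarrow> fock_op \<Rightarrow> bool" where
  "wcomp_op \<psi> \<phi> W \<longleftrightarrow>
     (\<exists>V. fock_subspace V \<and> V \<subseteq> dom (wcomp_max \<psi> \<phi>) \<and> W = wcomp_max \<psi> \<phi> |` V)"

definition wcomp_conj :: "complex \<Rightarrow> complex \<Rightarrow> complex \<Rightarrow> cfun \<Rightarrow> cfun" where
  "wcomp_conj a b c f = (\<lambda>z. c * exp (b * z) * cnj (f (cnj (a * z + b))))"

end

theory Submission
  imports Defs "HOL-Complex_Analysis.Complex_Analysis" "HOL-Probability.Distributions"
begin

text \<open>
  Write \<open>K\<^sub>w(z) = exp (z \<cdot> cnj w)\<close> for the reproducing kernels and \<open>J\<close> for the conjugation.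
  Every adjoint \<open>W\<^sup>*\<close> sends \<open>K\<^sub>z\<close> to \<open>cnj (\<psi> z) K\<^bsub>\<phi> z\<^esub>\<close>, so selfadjointness on \<open>J K\<^sub>z\<close> is the functional equation
  \<open>\<psi> w exp (b \<phi> w + z (a \<phi> w + b)) = \<psi> z exp (b w + \<phi> z (a w + b))\<close>. At \<open>z = 0\<close> it expresses \<open>\<psi>\<close>
  through \<open>\<phi>\<close>, and then it forces \<open>\<phi>\<close> to be affine.

  Conversely let \<open>T u = C exp (D z) u (A z + B)\<close> on its maximal domain. Testing against the kernels
  shows \<open>J T\<^sup>* J \<subseteq> T\<close>. The other inclusion needs \<open>\<langle>T u, g\<rangle> = \<langle>u, S g\<rangle>\<close> on the maximal domains, where
  \<open>S g = cnj C exp (cnj B z) g (cnj A z + cnj D)\<close>. Dilations \<open>R\<^sub>t\<close>, \<open>Q\<^sub>t\<close> with \<open>R\<^sub>t T = T Q\<^sub>t\<close> make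
  \<open>\<langle>R\<^sub>t T u, g\<rangle>\<close> and \<open>\<langle>Q\<^sub>t u, S g\<rangle>\<close> holomorphic in \<open>t\<close>. For small \<open>t\<close> all operators are bounded and
  the two agree; analytic continuation and the limit \<open>t \<rightarrow> 1\<close> give the claim.
\<close>

section \<open>Lebesgue measure on the complex plane\<close>

lemma measurable_Complex [measurable (raw)]:
  assumes [measurable]: "f \<in> borel_measurable M" "g \<in> borel_measurable M"
  shows "(\<lambda>x. Complex (f x) (g x)) \<in> borel_measurable M"
  unfolding Complex_eq by measurable

text \<open>Lebesgue measure is determined by its values on boxes, and a complex box is the product
  of two real intervals. This opens the way to iterated real integrals.\<close>

lemma lborel_complex_eq:
  "(lborel :: complex measure) = distr (lborel \<Otimes>\<^sub>M lborel) borel (\<lambda>(x, y). Complex x y)"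
proof (rule lborel_eqI)
  fix l u :: complex assume le: "\<And>b. b \<in> Basis \<Longrightarrow> l \<bullet> b \<le> u \<bullet> b"
  have "Re l \<le> Re u" "Im l \<le> Im u" using le[of 1] le[of \<i>] by (auto simp: Basis_complex_def)
  moreover have "(\<lambda>(x, y). Complex x y) -` box l u = box (Re l) (Re u) \<times> box (Im l) (Im u)"
    by (auto simp: in_box_complex_iff box_real)
  ultimately show "emeasure (distr (lborel \<Otimes>\<^sub>M lborel) borel (\<lambda>(x, y). Complex x y)) (box l u)
    = (\<Prod>b\<in>Basis. (u - l) \<bullet> b)"
    by (simp add: emeasure_distr space_pair_measure lborel.emeasure_pair_measure_Times
        Basis_complex_def ennreal_mult box_real)
qed simp

lemma nn_integral_lborel_complex:
  assumes [measurable]: "f \<in> borel_measurable (borel :: complex measure)"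
  shows "(\<integral>\<^sup>+z. f z \<partial>lborel) = (\<integral>\<^sup>+x. \<integral>\<^sup>+y. f (Complex x y) \<partial>lborel \<partial>lborel)"
    and "(\<integral>\<^sup>+z. f z \<partial>lborel) = (\<integral>\<^sup>+y. \<integral>\<^sup>+x. f (Complex x y) \<partial>lborel \<partial>lborel)"
proof -
  have *: "(\<lambda>(x, y). f (Complex x y)) \<in> borel_measurable (lborel \<Otimes>\<^sub>M lborel)"
    by measurable
  have "(\<integral>\<^sup>+z. f z \<partial>lborel) = (\<integral>\<^sup>+p. f (case p of (x, y) \<Rightarrow> Complex x y) \<partial>(lborel \<Otimes>\<^sub>M lborel))"
    by (subst lborel_complex_eq) (simp add: nn_integral_distr)
  also have "\<dots> = (\<integral>\<^sup>+p. (\<lambda>(x, y). f (Complex x y)) p \<partial>(lborel \<Otimes>\<^sub>M lborel))"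
    by (simp add: case_prod_beta)
  finally have e: "(\<integral>\<^sup>+z. f z \<partial>lborel) = (\<integral>\<^sup>+p. (\<lambda>(x, y). f (Complex x y)) p \<partial>(lborel \<Otimes>\<^sub>M lborel))" .
  show "(\<integral>\<^sup>+z. f z \<partial>lborel) = (\<integral>\<^sup>+x. \<integral>\<^sup>+y. f (Complex x y) \<partial>lborel \<partial>lborel)"
    unfolding e using lborel.nn_integral_fst[OF *] by simp
  show "(\<integral>\<^sup>+z. f z \<partial>lborel) = (\<integral>\<^sup>+y. \<integral>\<^sup>+x. f (Complex x y) \<partial>lborel \<partial>lborel)"
    unfolding e using lborel_pair.nn_integral_snd[OF *] by simp
qed

text \<open>Multiplication by \<open>t = Complex \<alpha> \<beta>\<close> is the composition of two
  real substitutions, one in each coordinate: first \<open>y\<close> becomes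
  \<open>\<beta> / \<alpha> * x + d * y\<close> for fixed \<open>x\<close>, then, after exchanging
  the integrals, \<open>x\<close> becomes \<open>\<alpha> * x - \<beta> * y\<close> for fixed
  \<open>y\<close>. The Jacobians \<open>d\<close> and \<open>\<alpha>\<close> multiply to the
  squared modulus of \<open>t\<close>; the division by \<open>\<alpha>\<close> is why the real part
  must not vanish.\<close>

lemma nn_integral_complex_mult_Re:
  assumes [measurable]: "f \<in> borel_measurable (borel :: complex measure)" and "Re t \<noteq> 0"
  shows "(\<integral>\<^sup>+z. f z \<partial>lborel) = ennreal ((cmod t)\<^sup>2) * (\<integral>\<^sup>+z. f (t * z) \<partial>lborel)"
proof -
  obtain \<alpha> \<beta> where t: "t = Complex \<alpha> \<beta>" by (cases t)
  have a: "\<alpha> \<noteq> 0" using assms t by simp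
  define d where "d = (\<alpha>\<^sup>2 + \<beta>\<^sup>2) / \<alpha>"
  have "\<alpha>\<^sup>2 + \<beta>\<^sup>2 > 0" using a by (simp add: sum_power2_gt_zero_iff)
  hence d: "d \<noteq> 0" using a by (simp add: d_def)
  have ad: "\<bar>\<alpha>\<bar> * \<bar>d\<bar> = (cmod t)\<^sup>2" using a by (simp add: d_def t cmod_power2 abs_mult[symmetric])
  have "(\<integral>\<^sup>+z. f z \<partial>lborel) = (\<integral>\<^sup>+x. \<integral>\<^sup>+y. f (Complex x y) \<partial>lborel \<partial>lborel)"
    by (rule nn_integral_lborel_complex) fact
  also have "\<dots> = (\<integral>\<^sup>+x. ennreal \<bar>d\<bar> * (\<integral>\<^sup>+y. f (Complex x (\<beta> / \<alpha> * x + d * y)) \<partial>lborel) \<partial>lborel)"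
  proof (rule nn_integral_cong)
    fix x :: real
    show "(\<integral>\<^sup>+y. f (Complex x y) \<partial>lborel) = ennreal \<bar>d\<bar> * (\<integral>\<^sup>+y. f (Complex x (\<beta> / \<alpha> * x + d * y)) \<partial>lborel)"
      using d by (intro nn_integral_real_affine) measurable
  qed
  also have "\<dots> = ennreal \<bar>d\<bar> * (\<integral>\<^sup>+x. (\<integral>\<^sup>+y. f (Complex x (\<beta> / \<alpha> * x + d * y)) \<partial>lborel) \<partial>lborel)"
    by (intro nn_integral_cmult) measurable
  also have "(\<integral>\<^sup>+x. (\<integral>\<^sup>+y. f (Complex x (\<beta> / \<alpha> * x + d * y)) \<partial>lborel) \<partial>lborel)
     = (\<integral>\<^sup>+y. (\<integral>\<^sup>+x. f (Complex x (\<beta> / \<alpha> * x + d * y)) \<partial>lborel) \<partial>lborel)"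
    by (intro lborel_pair.Fubini') measurable
  also have "\<dots> = (\<integral>\<^sup>+y. ennreal \<bar>\<alpha>\<bar> * (\<integral>\<^sup>+x. f (t * Complex x y) \<partial>lborel) \<partial>lborel)"
  proof (rule nn_integral_cong)
    fix y :: real
    have eq: "Complex (- \<beta> * y + \<alpha> * x) (\<beta> / \<alpha> * (- \<beta> * y + \<alpha> * x) + d * y) = t * Complex x y" for x
      using a by (simp add: t d_def complex_eq_iff field_simps power2_eq_square)
    have "(\<integral>\<^sup>+x. f (Complex x (\<beta> / \<alpha> * x + d * y)) \<partial>lborel) = ennreal \<bar>\<alpha>\<bar> *
      (\<integral>\<^sup>+x. f (Complex (- \<beta> * y + \<alpha> * x) (\<beta> / \<alpha> * (- \<beta> * y + \<alpha> * x) + d * y)) \<partial>lborel)"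
      using a by (intro nn_integral_real_affine[where f = "\<lambda>x. f (Complex x (\<beta> / \<alpha> * x + d * y))"]) measurable
    thus "(\<integral>\<^sup>+x. f (Complex x (\<beta> / \<alpha> * x + d * y)) \<partial>lborel) = ennreal \<bar>\<alpha>\<bar> *
      (\<integral>\<^sup>+x. f (t * Complex x y) \<partial>lborel)" unfolding eq .
  qed
  also have "\<dots> = ennreal \<bar>\<alpha>\<bar> * (\<integral>\<^sup>+y. (\<integral>\<^sup>+x. f (t * Complex x y) \<partial>lborel) \<partial>lborel)"
    by (intro nn_integral_cmult) measurable
  also have "(\<integral>\<^sup>+y. (\<integral>\<^sup>+x. f (t * Complex x y) \<partial>lborel) \<partial>lborel) = (\<integral>\<^sup>+z. f (t * z) \<partial>lborel)"
    by (rule nn_integral_lborel_complex(2)[symmetric]) measurable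
  finally show ?thesis unfolding ad[symmetric]
    by (simp add: ennreal_mult' mult_ac)
qed

lemma nn_integral_complex_affine:
  assumes [measurable]: "f \<in> borel_measurable (borel :: complex measure)" and "t \<noteq> 0"
  shows "(\<integral>\<^sup>+z. f z \<partial>lborel) = ennreal ((cmod t)\<^sup>2) * (\<integral>\<^sup>+z. f (t * z + p) \<partial>lborel)"
proof -
  define g where "g z = f (z + p)" for z
  have g [measurable]: "g \<in> borel_measurable borel" unfolding g_def by measurable
  have "(\<integral>\<^sup>+z. f z \<partial>lborel) = (\<integral>\<^sup>+z. f z \<partial>distr lborel borel (\<lambda>z. p + z))"
    by (simp add: lborel_distr_plus)
  also have "\<dots> = (\<integral>\<^sup>+z. g z \<partial>lborel)"
    by (subst nn_integral_distr) (simp_all add: g_def[abs_def] add.commute)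
  also have "\<dots> = ennreal ((cmod t)\<^sup>2) * (\<integral>\<^sup>+z. g (t * z) \<partial>lborel)"
  proof (cases "Re t = 0")
    case False
    thus ?thesis by (intro nn_integral_complex_mult_Re g)
  next
    case True
    \<comment> \<open>A purely imaginary \<open>t\<close> is split as \<open>s * (1 + \<i>)\<close>;
      both factors have nonzero real part, so the previous substitution applies twice.\<close>
    define s where "s = t / Complex 1 1"
    have s: "Re s \<noteq> 0" "t = s * Complex 1 1"
      using True \<open>t \<noteq> 0\<close> by (auto simp: s_def Re_divide complex_eq_iff Im_divide power2_eq_square)
    have "(\<integral>\<^sup>+z. g z \<partial>lborel) = ennreal ((cmod s)\<^sup>2) * (\<integral>\<^sup>+z. g (s * z) \<partial>lborel)"
      by (intro nn_integral_complex_mult_Re g s)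
    also have "(\<integral>\<^sup>+z. g (s * z) \<partial>lborel) =
        ennreal ((cmod (Complex 1 1))\<^sup>2) * (\<integral>\<^sup>+z. g (s * (Complex 1 1 * z)) \<partial>lborel)"
      by (intro nn_integral_complex_mult_Re[where f = "\<lambda>z. g (s * z)"]) auto
    finally show ?thesis
      unfolding s by (simp add: mult_ac norm_mult power_mult_distrib ennreal_mult')
  qed
  finally show ?thesis by (simp add: g_def)
qed

lemma integrable_complex_affine:
  fixes f :: "complex \<Rightarrow> 'a :: {banach, second_countable_topology}"
  assumes "integrable lborel f" "t \<noteq> 0"
  shows "integrable lborel (\<lambda>z. f (t * z + p))"
proof -
  have [measurable]: "f \<in> borel_measurable borel" using assms(1) by auto
  have "(\<integral>\<^sup>+z. norm (f z) \<partial>lborel) = ennreal ((cmod t)\<^sup>2) * (\<integral>\<^sup>+z. norm (f (t * z + p)) \<partial>lborel)"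
    using assms(2) by (intro nn_integral_complex_affine[where f = "\<lambda>z. ennreal (norm (f z))"]) auto
  with assms show ?thesis
    by (auto simp: integrable_iff_bounded ennreal_mult_less_top)
qed

text \<open>The substitution rule for indicator functions, read as an identity of measures; in this
  form it transfers to Bochner integrals.\<close>

lemma lborel_complex_affine:
  "t \<noteq> 0 \<Longrightarrow> (lborel :: complex measure) =
    density (distr lborel borel (\<lambda>z. t * z + p)) (\<lambda>_. ennreal ((cmod t)\<^sup>2))"
proof (rule measure_eqI)
  fix A :: "complex set" assume t: "t \<noteq> 0" and "A \<in> sets lborel"
  hence [measurable]: "A \<in> sets borel" by simp
  have "emeasure lborel A = (\<integral>\<^sup>+z. indicator A z \<partial>lborel)" by simp
  also have "\<dots> = ennreal ((cmod t)\<^sup>2) * (\<integral>\<^sup>+z. indicator A (t * z + p) \<partial>lborel)"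
    using t by (intro nn_integral_complex_affine) auto
  also have "(\<integral>\<^sup>+z. indicator A (t * z + p) \<partial>lborel) = emeasure (distr lborel borel (\<lambda>z. t * z + p)) A"
    by (subst nn_integral_distr[symmetric, where f = "indicator A" and M' = borel]) auto
  finally show "emeasure lborel A =
      emeasure (density (distr lborel borel (\<lambda>z. t * z + p)) (\<lambda>_. ennreal ((cmod t)\<^sup>2))) A"
    by (simp add: emeasure_density nn_integral_cmult)
qed simp

lemma integral_complex_affine:
  fixes f :: "complex \<Rightarrow> 'a :: {banach, second_countable_topology}"
  assumes "integrable lborel f" "t \<noteq> 0"
  shows "(LINT z|lborel. f z) = (cmod t)\<^sup>2 *\<^sub>R (LINT z|lborel. f (t * z + p))"
proof -
  have [measurable]: "f \<in> borel_measurable borel" using assms(1) by auto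
  show ?thesis
    by (subst lborel_complex_affine[OF assms(2), of p]) (simp add: integral_density integral_distr)
qed

text \<open>Conjugation is the reflection of the imaginary coordinate, hence a real substitution in
  the inner integral.\<close>

lemma integrable_complex_cnj:
  fixes f :: "complex \<Rightarrow> 'a :: {banach, second_countable_topology}"
  assumes "integrable lborel f"
  shows "integrable lborel (\<lambda>z. f (cnj z))"
proof -
  have [measurable]: "f \<in> borel_measurable borel" using assms(1) by auto
  have [measurable]: "cnj \<in> borel_measurable borel"
    by (auto intro!: borel_measurable_continuous_onI continuous_intros)
  have "(\<integral>\<^sup>+z. norm (f (cnj z)) \<partial>lborel) = (\<integral>\<^sup>+x. \<integral>\<^sup>+y. norm (f (cnj (Complex x y))) \<partial>lborel \<partial>lborel)"
    by (rule nn_integral_lborel_complex) measurable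
  also have "\<dots> = (\<integral>\<^sup>+x. \<integral>\<^sup>+y. norm (f (Complex x y)) \<partial>lborel \<partial>lborel)"
  proof (rule nn_integral_cong)
    fix x :: real
    show "(\<integral>\<^sup>+y. norm (f (cnj (Complex x y))) \<partial>lborel) = (\<integral>\<^sup>+y. norm (f (Complex x y)) \<partial>lborel)"
      by (subst (2) nn_integral_real_affine[where c = "-1" and t = 0]) (auto simp: complex_cnj)
  qed
  also have "\<dots> = (\<integral>\<^sup>+z. norm (f z) \<partial>lborel)"
    by (rule nn_integral_lborel_complex[symmetric]) measurable
  finally show ?thesis using assms
    by (auto simp: integrable_iff_bounded)
qed

section \<open>The Gaussian integral over the plane\<close>

lemma nn_integral_gaussian_complex: "(\<integral>\<^sup>+z. ennreal (exp (- (cmod z)\<^sup>2)) \<partial>lborel) = ennreal pi"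
proof -
  have *: "exp (- x\<^sup>2) = sqrt pi * normal_density 0 (1 / sqrt 2) x" for x
    by (simp add: normal_density_def power_divide)
  have f: "(\<integral>\<^sup>+x. ennreal (exp (- x\<^sup>2)) \<partial>lborel) = ennreal (sqrt pi)"
    unfolding * by (subst nn_integral_eq_integral) (auto intro!: integrable_mult_right)
  have "(\<integral>\<^sup>+z. ennreal (exp (- (cmod z)\<^sup>2)) \<partial>lborel)
     = (\<integral>\<^sup>+x. \<integral>\<^sup>+y. ennreal (exp (- (cmod (Complex x y))\<^sup>2)) \<partial>lborel \<partial>lborel)"
    by (rule nn_integral_lborel_complex) measurable
  also have "\<dots> = (\<integral>\<^sup>+x. \<integral>\<^sup>+y. ennreal (exp (- x\<^sup>2)) * ennreal (exp (- y\<^sup>2)) \<partial>lborel \<partial>lborel)"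
    by (simp add: cmod_power2 ennreal_mult'[symmetric] exp_add[symmetric] exp_diff[symmetric] algebra_simps)
  also have "\<dots> = ennreal (sqrt pi) * ennreal (sqrt pi)"
    by (simp add: nn_integral_cmult nn_integral_multc f)
  also have "\<dots> = ennreal pi" by (simp flip: ennreal_mult')
  finally show ?thesis .
qed

lemma integrable_gaussian_complex: "integrable lborel (\<lambda>z. exp (- (cmod z)\<^sup>2))"
  by (simp add: integrable_iff_bounded nn_integral_gaussian_complex)

lemma integral_gaussian_complex: "(LINT z|lborel. exp (- (cmod z)\<^sup>2)) = pi"
  by (subst integral_eq_nn_integral) (auto simp: nn_integral_gaussian_complex)

section \<open>The inner product of the Fock space\<close>

lemma borel_measurable_entire [measurable_dest]:
  "f holomorphic_on UNIV \<Longrightarrow> f \<in> borel_measurable (borel :: complex measure)"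
  by (intro borel_measurable_continuous_onI holomorphic_on_imp_continuous_on)

lemma fock_holomorphic: "f \<in> fock \<Longrightarrow> f holomorphic_on UNIV"
  by (simp add: fock_def)

lemma fock_measurable [measurable_dest]: "f \<in> fock \<Longrightarrow> f \<in> borel_measurable borel"
  by (auto simp: fock_def borel_measurable_entire)

lemma fock_integrable_norm2:
  "f \<in> fock \<Longrightarrow> integrable lborel (\<lambda>z. (cmod (f z))\<^sup>2 * exp (- (cmod z)\<^sup>2))"
  by (simp add: fock_def)

lemma fock_const: "(\<lambda>_. k) \<in> fock"
  using integrable_mult_right[OF integrable_gaussian_complex, of "(cmod k)\<^sup>2"] by (simp add: fock_def)

lemma fock_scale: assumes "f \<in> fock" shows "(\<lambda>z. k * f z) \<in> fock"
  using assms integrable_mult_right[OF fock_integrable_norm2[OF assms], of "(cmod k)\<^sup>2"]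
  by (auto simp: fock_def norm_mult power_mult_distrib mult_ac intro!: holomorphic_intros)

lemma fock_add: assumes f: "f \<in> fock" and g: "g \<in> fock" shows "(\<lambda>z. f z + g z) \<in> fock"
proof -
  have [measurable]: "f \<in> borel_measurable borel" "g \<in> borel_measurable borel"
    using f g by (auto dest: fock_measurable)
  have "integrable lborel (\<lambda>z. (cmod (f z + g z))\<^sup>2 * exp (- (cmod z)\<^sup>2))"
  proof (rule Bochner_Integration.integrable_bound)
    show "integrable lborel (\<lambda>z. 2 * ((cmod (f z))\<^sup>2 * exp (- (cmod z)\<^sup>2)) + 2 * ((cmod (g z))\<^sup>2 * exp (- (cmod z)\<^sup>2)))"
      using f g by (intro Bochner_Integration.integrable_add integrable_mult_right fock_integrable_norm2)
    have "(cmod (f z + g z))\<^sup>2 \<le> 2 * (cmod (f z))\<^sup>2 + 2 * (cmod (g z))\<^sup>2" for z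
    proof -
      have "(cmod (f z + g z))\<^sup>2 \<le> (cmod (f z) + cmod (g z))\<^sup>2"
        by (intro power_mono norm_triangle_ineq) auto
      also have "\<dots> \<le> 2 * (cmod (f z))\<^sup>2 + 2 * (cmod (g z))\<^sup>2"
        using zero_le_power2[of "cmod (f z) - cmod (g z)"] by (simp add: power2_eq_square algebra_simps)
      finally show ?thesis .
    qed
    hence "(cmod (f z + g z))\<^sup>2 * exp (- (cmod z)\<^sup>2) \<le>
      (2 * (cmod (f z))\<^sup>2 + 2 * (cmod (g z))\<^sup>2) * exp (- (cmod z)\<^sup>2)" for z
      by (intro mult_right_mono) auto
    thus "AE z in lborel. norm ((cmod (f z + g z))\<^sup>2 * exp (- (cmod z)\<^sup>2)) \<le>
      norm (2 * ((cmod (f z))\<^sup>2 * exp (- (cmod z)\<^sup>2)) + 2 * ((cmod (g z))\<^sup>2 * exp (- (cmod z)\<^sup>2)))"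
      by (auto simp: algebra_simps)
  qed measurable
  thus ?thesis using f g by (auto simp: fock_def intro!: holomorphic_intros)
qed

lemma fock_diff: "f \<in> fock \<Longrightarrow> g \<in> fock \<Longrightarrow> (\<lambda>z. f z - g z) \<in> fock"
  using fock_add[of f "\<lambda>z. -1 * g z"] fock_scale[of g "-1"] by simp

lemma fock_integrable_inner:
  assumes f: "f \<in> fock" and g: "g \<in> fock"
  shows "integrable lborel (\<lambda>z. f z * cnj (g z) * complex_of_real (exp (- (cmod z)\<^sup>2)))"
proof (rule Bochner_Integration.integrable_bound)
  have [measurable]: "f \<in> borel_measurable borel" "g \<in> borel_measurable borel"
    using f g by (auto dest: fock_measurable)
  have [measurable]: "cnj \<in> borel_measurable borel"
    by (auto intro!: borel_measurable_continuous_onI continuous_intros)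
  show "(\<lambda>z. f z * cnj (g z) * complex_of_real (exp (- (cmod z)\<^sup>2))) \<in> borel_measurable lborel"
    by measurable
  show "integrable lborel (\<lambda>z. (cmod (f z))\<^sup>2 * exp (- (cmod z)\<^sup>2) + (cmod (g z))\<^sup>2 * exp (- (cmod z)\<^sup>2))"
    using f g by (intro Bochner_Integration.integrable_add fock_integrable_norm2)
  have "cmod (f z) * cmod (g z) \<le> (cmod (f z))\<^sup>2 + (cmod (g z))\<^sup>2" for z
    using sum_squares_bound[of "cmod (f z)" "cmod (g z)"] mult_nonneg_nonneg[of "cmod (f z)" "cmod (g z)"]
    by (simp add: mult.assoc del: mult_nonneg_nonneg)
  hence "cmod (f z) * cmod (g z) * exp (- (cmod z)\<^sup>2) \<le>
      ((cmod (f z))\<^sup>2 + (cmod (g z))\<^sup>2) * exp (- (cmod z)\<^sup>2)" for z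
    by (intro mult_right_mono) auto
  thus "AE z in lborel. norm (f z * cnj (g z) * complex_of_real (exp (- (cmod z)\<^sup>2))) \<le>
      norm ((cmod (f z))\<^sup>2 * exp (- (cmod z)\<^sup>2) + (cmod (g z))\<^sup>2 * exp (- (cmod z)\<^sup>2))"
    by (auto simp: norm_mult algebra_simps)
qed

lemma fock_inner_cnj: "fock_inner g f = cnj (fock_inner f g)"
proof -
  have "cnj (LINT z|lborel. f z * cnj (g z) * complex_of_real (exp (- (cmod z)\<^sup>2))) =
    (LINT z|lborel. cnj (f z * cnj (g z) * complex_of_real (exp (- (cmod z)\<^sup>2))))"
    by (rule Bochner_Integration.integral_cnj[symmetric])
  thus ?thesis unfolding fock_inner_def by (simp add: mult_ac)
qed

lemma fock_inner_add_left:
  "f \<in> fock \<Longrightarrow> g \<in> fock \<Longrightarrow> h \<in> fock \<Longrightarrow>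
    fock_inner (\<lambda>z. f z + g z) h = fock_inner f h + fock_inner g h"
  using fock_integrable_inner[of f h] fock_integrable_inner[of g h]
  by (simp add: fock_inner_def algebra_simps)

lemma fock_inner_scale_left: "fock_inner (\<lambda>z. k * f z) h = k * fock_inner f h"
  unfolding fock_inner_def mult.assoc by simp

lemma fock_inner_diff_left:
  "f \<in> fock \<Longrightarrow> g \<in> fock \<Longrightarrow> h \<in> fock \<Longrightarrow>
    fock_inner (\<lambda>z. f z - g z) h = fock_inner f h - fock_inner g h"
  using fock_integrable_inner[of f h] fock_integrable_inner[of g h]
  by (simp add: fock_inner_def algebra_simps)

lemma fock_inner_scale_right: "fock_inner f (\<lambda>z. k * h z) = cnj k * fock_inner f h"
  by (simp add: fock_inner_cnj[of f] fock_inner_scale_left)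

lemma fock_inner_add_right:
  "f \<in> fock \<Longrightarrow> g \<in> fock \<Longrightarrow> h \<in> fock \<Longrightarrow>
    fock_inner h (\<lambda>z. f z + g z) = fock_inner h f + fock_inner h g"
  by (simp add: fock_inner_cnj[of h] fock_inner_add_left)

lemma fock_inner_diff_right:
  "f \<in> fock \<Longrightarrow> g \<in> fock \<Longrightarrow> h \<in> fock \<Longrightarrow>
    fock_inner h (\<lambda>z. f z - g z) = fock_inner h f - fock_inner h g"
  by (simp add: fock_inner_cnj[of h] fock_inner_diff_left)

lemma fock_inner_self:
  "fock_inner f f = complex_of_real (1 / pi * (LINT z|lborel. (cmod (f z))\<^sup>2 * exp (- (cmod z)\<^sup>2)))"
proof -
  have "f z * cnj (f z) * complex_of_real (exp (- (cmod z)\<^sup>2)) =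
      complex_of_real ((cmod (f z))\<^sup>2 * exp (- (cmod z)\<^sup>2))" for z
    by (simp add: complex_norm_square[symmetric])
  thus ?thesis unfolding fock_inner_def by (simp only: integral_complex_of_real) simp
qed

lemma fock_norm_square:
  "(fock_norm f)\<^sup>2 = 1 / pi * (LINT z|lborel. (cmod (f z))\<^sup>2 * exp (- (cmod z)\<^sup>2))"
  by (simp add: fock_norm_def fock_inner_self)

lemma fock_inner_self_norm: "fock_inner f f = complex_of_real ((fock_norm f)\<^sup>2)"
  by (simp add: fock_norm_square fock_inner_self)

lemma fock_norm_nonneg [simp]: "0 \<le> fock_norm f"
  by (simp add: fock_norm_def fock_inner_self)

lemma fock_norm_scale: "fock_norm (\<lambda>z. k * f z) = cmod k * fock_norm f"
proof -
  have "complex_of_real ((fock_norm (\<lambda>z. k * f z))\<^sup>2) = (k * cnj k) * fock_inner f f"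
    by (simp only: fock_inner_self_norm[symmetric] fock_inner_scale_left fock_inner_scale_right mult.assoc)
  also have "\<dots> = complex_of_real ((cmod k * fock_norm f)\<^sup>2)"
    by (simp add: fock_inner_self_norm complex_norm_square[symmetric] power_mult_distrib)
  finally have "(fock_norm (\<lambda>z. k * f z))\<^sup>2 = (cmod k * fock_norm f)\<^sup>2"
    using of_real_eq_iff by blast
  thus ?thesis by (simp add: power2_eq_iff_nonneg)
qed

text \<open>This expansion is the common source of the Cauchy-Schwarz inequality, the parallelogram
  law and the one-dimensional minimisation in the density proof.\<close>

lemma fock_norm_diff_scale:
  assumes f: "f \<in> fock" and g: "g \<in> fock"
  shows "(fock_norm (\<lambda>z. f z - k * g z))\<^sup>2 =
    (fock_norm f)\<^sup>2 - 2 * Re (cnj k * fock_inner f g) + (cmod k)\<^sup>2 * (fock_norm g)\<^sup>2"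
proof -
  have kg: "(\<lambda>z. k * g z) \<in> fock" using g by (rule fock_scale)
  have d: "(\<lambda>z. f z - k * g z) \<in> fock" using f kg by (rule fock_diff)
  have "fock_inner (\<lambda>z. f z - k * g z) (\<lambda>z. f z - k * g z) =
    fock_inner f f - fock_inner f (\<lambda>z. k * g z) - (fock_inner (\<lambda>z. k * g z) f - fock_inner (\<lambda>z. k * g z) (\<lambda>z. k * g z))"
    by (simp only: fock_inner_diff_left[OF f kg d] fock_inner_diff_right[OF f kg f] fock_inner_diff_right[OF f kg kg])
  moreover have "fock_inner (\<lambda>z. k * g z) f = cnj (cnj k * fock_inner f g)"
    by (simp add: fock_inner_scale_left fock_inner_cnj[of g f])
  ultimately have "Re (fock_inner (\<lambda>z. f z - k * g z) (\<lambda>z. f z - k * g z)) =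
    (fock_norm f)\<^sup>2 - 2 * Re (cnj k * fock_inner f g) + (fock_norm (\<lambda>z. k * g z))\<^sup>2"
    by (simp only: fock_inner_self_norm fock_inner_scale_right) simp
  thus ?thesis
    by (simp add: fock_inner_self_norm fock_norm_scale power_mult_distrib)
qed

lemma fock_Cauchy_Schwarz:
  assumes f: "f \<in> fock" and g: "g \<in> fock"
  shows "cmod (fock_inner f g) \<le> fock_norm f * fock_norm g"
proof -
  let ?I = "fock_inner f g"
  \<comment> \<open>Subtracting the multiple \<open>s * ?I\<close> of \<open>g\<close> with real
    \<open>s\<close> makes the cross term real, so a real quadratic polynomial in \<open>s\<close>
    is nonnegative.\<close>
  have *: "0 \<le> (fock_norm f)\<^sup>2 - 2 * s * (cmod ?I)\<^sup>2 + s\<^sup>2 * (cmod ?I)\<^sup>2 * (fock_norm g)\<^sup>2" for s :: real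
  proof -
    have "cnj (complex_of_real s * ?I) * ?I = complex_of_real (s * (cmod ?I)\<^sup>2)"
      by (simp only: complex_cnj_mult complex_cnj_complex_of_real of_real_mult complex_norm_square mult_ac)
    hence "Re (cnj (complex_of_real s * ?I) * ?I) = s * (cmod ?I)\<^sup>2"
      by (simp only: Re_complex_of_real)
    thus ?thesis
      using fock_norm_diff_scale[OF f g, of "complex_of_real s * ?I"]
        zero_le_power2[of "fock_norm (\<lambda>z. f z - complex_of_real s * ?I * g z)"]
      by (simp add: norm_mult power_mult_distrib)
  qed
  have "(cmod ?I)\<^sup>2 \<le> (fock_norm f * fock_norm g)\<^sup>2"
  proof (cases "fock_norm g = 0")
    case True
    have "?I = 0"
    proof (rule ccontr)
      assume "?I \<noteq> 0"
      \<comment> \<open>With \<open>g\<close> of norm zero the polynomial is affine in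
        \<open>s\<close>; at this \<open>s\<close> its value is
        \<open>- (fock_norm f)\<^sup>2 - 2\<close>.\<close>
      thus False using *[of "((fock_norm f)\<^sup>2 + 1) / (cmod ?I)\<^sup>2"] zero_le_power2[of "fock_norm f"] unfolding True by simp
    qed
    thus ?thesis by simp
  next
    case False
    define G where "G = (fock_norm g)\<^sup>2"
    have G: "G > 0" using False by (simp add: G_def)
    have "0 \<le> (fock_norm f)\<^sup>2 - (cmod ?I)\<^sup>2 / G"
      using *[of "1 / G"] G unfolding G_def[symmetric] by (simp add: field_simps power2_eq_square)
    thus ?thesis using G by (simp add: field_simps power_mult_distrib G_def)
  qed
  thus ?thesis by (rule power2_le_imp_le) simp
qed

lemma fock_parallelogram:
  assumes f: "f \<in> fock" and g: "g \<in> fock"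
  shows "(fock_norm (\<lambda>z. f z + g z))\<^sup>2 + (fock_norm (\<lambda>z. f z - g z))\<^sup>2
    = 2 * (fock_norm f)\<^sup>2 + 2 * (fock_norm g)\<^sup>2"
  using fock_norm_diff_scale[OF f g, of 1] fock_norm_diff_scale[OF f g, of "-1"] by simp

section \<open>Affine substitutions with exponential weight\<close>

text \<open>The bound \<open>M\<close> says that the squared weight times the Gaussian at
  \<open>z\<close> is at most \<open>exp M\<close> times the Gaussian at \<open>t * z + p\<close>.
  The substitution then costs only the Jacobian.\<close>

lemma fock_exp_affine:
  assumes f: "f \<in> fock" and t: "t \<noteq> 0"
    and M: "\<And>z. (cmod (t * z + p))\<^sup>2 + 2 * Re (q * z) - (cmod z)\<^sup>2 \<le> M"
  shows "(\<lambda>z. exp (q * z) * f (t * z + p)) \<in> fock"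
    and "(fock_norm (\<lambda>z. exp (q * z) * f (t * z + p)))\<^sup>2 \<le> exp M / (cmod t)\<^sup>2 * (fock_norm f)\<^sup>2"
proof -
  have hol: "(\<lambda>z. exp (q * z) * f (t * z + p)) holomorphic_on UNIV"
  proof -
    have "f \<circ> (\<lambda>z. t * z + p) holomorphic_on UNIV"
      by (rule holomorphic_on_compose_gen[OF _ fock_holomorphic[OF f]]) (auto intro!: holomorphic_intros)
    thus ?thesis by (auto intro!: holomorphic_intros simp: comp_def)
  qed
  have [measurable]: "(\<lambda>z. exp (q * z) * f (t * z + p)) \<in> borel_measurable borel"
    using hol by (rule borel_measurable_entire)
  let ?F = "\<lambda>z. (cmod (f z))\<^sup>2 * exp (- (cmod z)\<^sup>2)"
  have b: "(cmod (exp (q * z) * f (t * z + p)))\<^sup>2 * exp (- (cmod z)\<^sup>2) \<le> exp M * ?F (t * z + p)" for z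
  proof -
    have "(cmod (exp (q * z)))\<^sup>2 * exp (- (cmod z)\<^sup>2) = exp (2 * Re (q * z) - (cmod z)\<^sup>2)"
      by (simp add: power2_eq_square exp_add[symmetric])
    also have "\<dots> \<le> exp (M + - (cmod (t * z + p))\<^sup>2)"
      using M[of z] by (simp add: algebra_simps)
    finally have "(cmod (exp (q * z)))\<^sup>2 * exp (- (cmod z)\<^sup>2) \<le> exp M * exp (- (cmod (t * z + p))\<^sup>2)"
      by (simp only: exp_add)
    from mult_right_mono[OF this, of "(cmod (f (t * z + p)))\<^sup>2"] show ?thesis
      by (simp add: norm_mult power_mult_distrib mult_ac)
  qed
  have i: "integrable lborel (\<lambda>z. exp M * ?F (t * z + p))"
    by (intro integrable_mult_right integrable_complex_affine[where f = ?F] fock_integrable_norm2 f t)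
  have j: "integrable lborel (\<lambda>z. (cmod (exp (q * z) * f (t * z + p)))\<^sup>2 * exp (- (cmod z)\<^sup>2))"
    by (rule Bochner_Integration.integrable_bound[OF i])
      (use b in \<open>auto intro: order_trans\<close>)
  show "(\<lambda>z. exp (q * z) * f (t * z + p)) \<in> fock"
    using hol j by (simp add: fock_def)
  have "(LINT z|lborel. (cmod (exp (q * z) * f (t * z + p)))\<^sup>2 * exp (- (cmod z)\<^sup>2))
      \<le> (LINT z|lborel. exp M * ?F (t * z + p))"
    by (intro integral_mono i j b)
  also have "\<dots> = exp M / (cmod t)\<^sup>2 * (LINT z|lborel. ?F z)"
    using integral_complex_affine[OF fock_integrable_norm2[OF f] t, of p] t by simp
  finally show "(fock_norm (\<lambda>z. exp (q * z) * f (t * z + p)))\<^sup>2 \<le> exp M / (cmod t)\<^sup>2 * (fock_norm f)\<^sup>2"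
    unfolding fock_norm_square by (simp add: divide_right_mono flip: divide_divide_eq_left)
qed

text \<open>Separates the exponent into linear, constant and quadratic parts. For
  \<open>cmod t = 1\<close> it is bounded once \<open>t * cnj p + q\<close> vanishes; for
  \<open>cmod t < 1\<close> the negative quadratic part absorbs any linear part.\<close>

lemma cmod_affine_square:
  "(cmod (t * z + p))\<^sup>2 + 2 * Re (q * z) - (cmod z)\<^sup>2 =
    2 * Re ((t * cnj p + q) * z) + (cmod p)\<^sup>2 - (1 - (cmod t)\<^sup>2) * (cmod z)\<^sup>2"
  by (simp only: cmod_power2) (simp add: algebra_simps power2_eq_square)

lemma fock_exp: "(\<lambda>z. exp (q * z)) \<in> fock"
proof -
  \<comment> \<open>The translation by \<open>- cnj q\<close>, invisible on the constant function 1,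
    is chosen so that the linear part of the exponent cancels.\<close>
  have "(\<lambda>z. exp (q * z) * (\<lambda>_. 1) (1 * z + - cnj q)) \<in> fock"
    by (rule fock_exp_affine(1)[where M = "(cmod q)\<^sup>2" and t = 1 and p = "- cnj q"])
      (simp_all only: cmod_affine_square fock_const, simp_all)
  thus ?thesis by simp
qed

section \<open>Reproducing kernels and their density\<close>

text \<open>Cauchy's integral formula on the unit circle for \<open>u\<close> mapped to
  \<open>f (u * z)\<close>, so circles of every radius are covered at once.\<close>

lemma entire_circle_mean:
  assumes "f holomorphic_on UNIV"
  shows "(LINT \<theta>|lborel. indicator {0..1} \<theta> *\<^sub>R f (exp (2 * of_real pi * \<i> * of_real \<theta>) * z)) = f 0"
proof -
  let ?E = "\<lambda>\<theta>::real. exp (2 * of_real pi * \<i> * of_real \<theta>)"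
  have "f \<circ> (\<lambda>u. u * z) holomorphic_on UNIV"
    by (rule holomorphic_on_compose_gen[OF _ assms]) (auto intro!: holomorphic_intros)
  hence "(\<lambda>u. f (u * z)) holomorphic_on cball 0 1"
    using holomorphic_on_subset by (auto simp: comp_def)
  from Cauchy_integral_circlepath_simple[OF this, of 0]
  have "((\<lambda>\<theta>. f (?E \<theta> * z) / ?E \<theta> * (2 * of_real pi * \<i> * ?E \<theta>)) has_integral (2 * of_real pi * \<i> * f 0)) {0..1}"
    unfolding has_contour_integral vector_derivative_circlepath by (simp add: circlepath)
  from has_integral_mult_right[OF this, of "1 / (2 * of_real pi * \<i>)"]
  have hi: "((\<lambda>\<theta>. f (?E \<theta> * z)) has_integral f 0) {0..1}"
    by simp
  have "continuous_on {0..1} (\<lambda>\<theta>. f (?E \<theta> * z))"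
    by (rule continuous_on_compose2[OF holomorphic_on_imp_continuous_on[OF assms]])
      (auto intro!: continuous_intros)
  hence "set_integrable lborel {0..1} (\<lambda>\<theta>. f (?E \<theta> * z))"
    unfolding set_integrable_def by (intro borel_integrable_compact) auto
  from set_borel_integral_eq_integral(2)[OF this] show ?thesis
    using hi by (simp add: set_lebesgue_integral_def integral_unique)
qed

text \<open>The Gaussian weight and Lebesgue measure are invariant under rotations. Averaging over
  all rotations and exchanging the integrals replaces \<open>f\<close> by its circle means, which
  all equal \<open>f 0\<close>.\<close>

lemma fock_gaussian_mean:
  assumes f: "f \<in> fock"
  shows "(LINT z|lborel. f z * complex_of_real (exp (- (cmod z)\<^sup>2))) = complex_of_real pi * f 0"
proof -
  let ?E = "\<lambda>\<theta>::real. exp (2 * of_real pi * \<i> * of_real \<theta>)"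
  define G where "G z = f z * complex_of_real (exp (- (cmod z)\<^sup>2))" for z
  define H where "H \<theta> z = indicator {0..1} \<theta> *\<^sub>R G (?E \<theta> * z)" for \<theta> z
  have G: "integrable lborel G"
    using fock_integrable_inner[OF f fock_const[of 1]] by (simp add: G_def[abs_def])
  have [measurable]: "G \<in> borel_measurable borel" using G by auto
  have E: "cmod (?E \<theta>) = 1" "?E \<theta> \<noteq> 0" for \<theta> by (simp_all)
  have rot: "integrable lborel (\<lambda>z. G (?E \<theta> * z))" for \<theta>
    using integrable_complex_affine[OF G E(2), of _ 0] by simp
  have rot_eq: "(LINT z|lborel. G (?E \<theta> * z)) = (LINT z|lborel. G z)" for \<theta>
    using integral_complex_affine[OF G E(2), of _ 0] E(1)[of \<theta>] by simp
  have rot_norm: "(LINT z|lborel. norm (G (?E \<theta> * z))) = (LINT z|lborel. norm (G z))" for \<theta>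
    using integral_complex_affine[OF integrable_norm[OF G] E(2), of _ 0] E(1)[of \<theta>] by simp
  have [measurable]: "case_prod H \<in> borel_measurable (lborel \<Otimes>\<^sub>M lborel)"
    unfolding H_def by measurable
  have H: "integrable (lborel \<Otimes>\<^sub>M lborel) (case_prod H)"
  \<comment> \<open>Rotation invariance also makes the inner integrals of the norm independent of
    the angle, which gives absolute integrability of \<open>H\<close>.\<close>
  proof (rule lborel_pair.Fubini_integrable)
    have "integrable lborel (\<lambda>\<theta>::real. indicator {0..1} \<theta> * (LINT z|lborel. norm (G z)))"
      by (intro integrable_mult_left) auto
    also have "(\<lambda>\<theta>::real. indicator {0..1} \<theta> * (LINT z|lborel. norm (G z)))
        = (\<lambda>\<theta>. LINT z|lborel. norm (case_prod H (\<theta>, z)))"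
      by (simp add: H_def rot_norm)
    finally show "integrable lborel (\<lambda>\<theta>. LINT z|lborel. norm (case_prod H (\<theta>, z)))" .
    show "AE \<theta> in lborel. integrable lborel (\<lambda>z. case_prod H (\<theta>, z))"
      by (auto simp: H_def rot)
  qed measurable
  have "H \<theta> z = of_real (exp (- (cmod z)\<^sup>2)) * (indicator {0..1} \<theta> *\<^sub>R f (?E \<theta> * z))" for \<theta> z
    by (simp add: H_def G_def norm_mult scaleR_conv_of_real)
  hence 1: "(LINT \<theta>|lborel. H \<theta> z) = f 0 * of_real (exp (- (cmod z)\<^sup>2))" for z
    using entire_circle_mean[OF fock_holomorphic[OF f], of z]
    by (simp del: mult_scaleR_right scaleR_conv_of_real)
  have "(LINT z|lborel. G z) = (LINT \<theta>|lborel. indicator {0..1::real} \<theta> *\<^sub>R (LINT z|lborel. G z))"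
    by simp
  also have "\<dots> = (LINT \<theta>|lborel. (LINT z|lborel. H \<theta> z))"
    by (simp add: H_def rot_eq)
  also have "\<dots> = (LINT z|lborel. (LINT \<theta>|lborel. H \<theta> z))"
    by (rule lborel_pair.Fubini_integral[OF H, symmetric])
  also have "\<dots> = (LINT z|lborel. f 0 * of_real (exp (- (cmod z)\<^sup>2)))"
    unfolding 1 ..
  also have "\<dots> = f 0 * of_real pi"
    by (simp only: integral_mult_right_zero integral_complex_of_real integral_gaussian_complex)
  finally show ?thesis by (simp add: G_def mult.commute)
qed

abbreviation fock_kernel :: "complex \<Rightarrow> cfun" where
  "fock_kernel w \<equiv> (\<lambda>z. exp (cnj w * z))"

text \<open>The weighted translation \<open>F\<close> moves the point \<open>w\<close> to the
  origin: its integrand against the Gaussian is the translated integrand of the inner product, and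
  \<open>F 0 = f w\<close>. The Gaussian mean of \<open>F\<close> then gives the value.\<close>

lemma fock_reproducing:
  assumes f: "f \<in> fock"
  shows "fock_inner f (fock_kernel w) = f w"
proof -
  define F where "F = (\<lambda>z. exp (- cnj w * z) * f (1 * z + w))"
  have F: "F \<in> fock" unfolding F_def
    by (rule fock_exp_affine(1)[OF f, where M = "(cmod w)\<^sup>2"]) (simp, simp only: cmod_affine_square, simp)
  define \<Phi> where "\<Phi> z = f z * cnj (exp (cnj w * z)) * complex_of_real (exp (- (cmod z)\<^sup>2))" for z
  have "\<Phi> (1 * z + w) = F z * complex_of_real (exp (- (cmod z)\<^sup>2))" for z
  proof -
    have "w * cnj (z + w) - complex_of_real ((cmod (z + w))\<^sup>2)
        = - cnj w * z - complex_of_real ((cmod z)\<^sup>2)"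
      by (simp only: complex_norm_square) (simp add: algebra_simps)
    hence "exp (w * cnj (z + w)) * exp (complex_of_real (- (cmod (z + w))\<^sup>2))
        = exp (- cnj w * z) * exp (complex_of_real (- (cmod z)\<^sup>2))"
      by (simp flip: exp_add)
    hence "exp (w * cnj (z + w)) * complex_of_real (exp (- (cmod (z + w))\<^sup>2))
        = exp (- cnj w * z) * complex_of_real (exp (- (cmod z)\<^sup>2))"
      by (simp only: exp_of_real)
    thus ?thesis by (simp add: \<Phi>_def F_def exp_cnj mult_ac)
  qed
  moreover have "integrable lborel \<Phi>"
    unfolding \<Phi>_def by (rule fock_integrable_inner[OF f fock_exp])
  ultimately have "(LINT z|lborel. \<Phi> z) = (LINT z|lborel. F z * complex_of_real (exp (- (cmod z)\<^sup>2)))"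
    using integral_complex_affine[of \<Phi> 1 w] by simp
  also have "\<dots> = complex_of_real pi * F 0" by (rule fock_gaussian_mean[OF F])
  finally show ?thesis by (simp add: fock_inner_def \<Phi>_def F_def)
qed

lemma fock_kernel_reproducing:
  "f \<in> fock \<Longrightarrow> fock_inner (fock_kernel w) f = cnj (f w)"
  using fock_reproducing fock_inner_cnj by metis

lemma fock_norm_kernel: "(fock_norm (fock_kernel w))\<^sup>2 = exp ((cmod w)\<^sup>2)"
proof -
  have "complex_of_real ((fock_norm (fock_kernel w))\<^sup>2) = exp (cnj w * w)"
    by (simp only: fock_inner_self_norm[symmetric] fock_reproducing[OF fock_exp])
  also have "\<dots> = complex_of_real (exp ((cmod w)\<^sup>2))"
    by (simp only: exp_of_real[symmetric] complex_norm_square mult.commute)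
  finally show ?thesis using of_real_eq_iff by blast
qed

lemma fock_pointwise_bound:
  assumes "f \<in> fock"
  shows "cmod (f w) \<le> fock_norm f * fock_norm (fock_kernel w)"
  using fock_Cauchy_Schwarz[OF assms fock_exp[of "cnj w"]] by (simp add: fock_reproducing[OF assms])

text \<open>A minimising sequence in \<open>V\<close> for the distance to \<open>f\<close> is used
  without appeal to completeness. Minimality against multiples of kernels forces pointwise
  convergence to \<open>f\<close>, the parallelogram law makes the sequence Cauchy, and Fatou's
  lemma combines both into norm convergence.\<close>

lemma fock_kernel_dense:
  assumes V: "fock_subspace V" and K: "\<And>w. fock_kernel w \<in> V" and f: "f \<in> fock" and e: "e > 0"
  shows "\<exists>g\<in>V. fock_norm (\<lambda>z. f z - g z) < e"
proof -
  have V_fock: "v \<in> fock" if "v \<in> V" for v using V that by (auto simp: fock_subspace_def)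
  have V_add: "(\<lambda>z. u z + v z) \<in> V" if "u \<in> V" "v \<in> V" for u v
    using V that by (auto simp: fock_subspace_def)
  have V_scale: "(\<lambda>z. k * v z) \<in> V" if "v \<in> V" for k v
    using V that by (auto simp: fock_subspace_def)
  define S where "S = (\<lambda>v. (fock_norm (\<lambda>z. f z - v z))\<^sup>2) ` V"
  define d where "d = Inf S"
  have ne: "S \<noteq> {}" using K by (auto simp: S_def)
  have bdd: "bdd_below S" by (rule bdd_belowI[of _ 0]) (auto simp: S_def)
  have low: "d \<le> (fock_norm (\<lambda>z. f z - v z))\<^sup>2" if "v \<in> V" for v
    unfolding d_def by (rule cInf_lower[OF _ bdd]) (use that in \<open>auto simp: S_def\<close>)
  have "\<exists>v\<in>V. (fock_norm (\<lambda>z. f z - v z))\<^sup>2 < d + 1 / Suc n" for n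
  proof -
    have "Inf S < d + 1 / Suc n" by (simp add: d_def)
    from cInf_lessD[OF ne this] show ?thesis by (auto simp: S_def)
  qed
  then obtain v where v: "\<And>n. v n \<in> V"
    and v_lt: "\<And>n. (fock_norm (\<lambda>z. f z - v n z))\<^sup>2 < d + 1 / Suc n" by metis
  have fv: "(\<lambda>z. f z - v n z) \<in> fock" for n using f v V_fock by (intro fock_diff) auto
  \<comment> \<open>The midpoint of \<open>v n\<close> and \<open>v m\<close> lies in
    \<open>V\<close>, so its squared distance from \<open>f\<close> is at least \<open>d\<close>;
    the parallelogram law bounds what is left.\<close>
  have cauchy: "(fock_norm (\<lambda>z. v m z - v n z))\<^sup>2 \<le> 2 / Suc n + 2 / Suc m" for m n
  proof -
    have avg: "(\<lambda>z. (1/2) * (v n z + v m z)) \<in> V" using v by (intro V_scale V_add)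
    have eq: "(\<lambda>z. (f z - v n z) + (f z - v m z)) = (\<lambda>z. 2 * (f z - (1/2) * (v n z + v m z)))"
      by (auto simp: field_simps)
    have "(fock_norm (\<lambda>z. (f z - v n z) + (f z - v m z)))\<^sup>2 \<ge> 4 * d"
      using low[OF avg] unfolding eq fock_norm_scale by (simp add: power_mult_distrib)
    moreover have "(\<lambda>z. (f z - v n z) - (f z - v m z)) = (\<lambda>z. v m z - v n z)"
      by auto
    ultimately show ?thesis
      using fock_parallelogram[OF fv[of n] fv[of m]] v_lt[of n] v_lt[of m] by simp
  qed
  have pt: "(cmod (f w - v n w))\<^sup>2 \<le> exp ((cmod w)\<^sup>2) / Suc n" for w n
  proof -
    define h where "h = (\<lambda>z. f z - v n z)"
    define N where "N = exp ((cmod w)\<^sup>2)"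
    \<comment> \<open>The coefficient of the orthogonal projection of \<open>h\<close> onto the
      kernel at \<open>w\<close>. Subtracting this projection lowers the squared norm by
      \<open>(cmod (h w))\<^sup>2 / N\<close>, while near-minimality allows a drop below
      \<open>1 / Suc n\<close> only.\<close>
    define k where "k = h w / N"
    have h: "h \<in> fock" unfolding h_def by (rule fv)
    have N: "N > 0" by (simp add: N_def)
    have "(\<lambda>z. v n z + k * fock_kernel w z) \<in> V" by (intro V_add V_scale v K)
    from low[OF this] have "d \<le> (fock_norm (\<lambda>z. h z - k * fock_kernel w z))\<^sup>2"
      by (simp add: h_def algebra_simps)
    also have "\<dots> = (fock_norm h)\<^sup>2 - 2 * Re (cnj k * h w) + (cmod k)\<^sup>2 * N"
      by (simp only: fock_norm_diff_scale[OF h fock_exp] fock_reproducing[OF h] fock_norm_kernel N_def)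
    also have "cnj k * h w = of_real ((cmod (h w))\<^sup>2 / N)"
      unfolding of_real_divide complex_norm_square by (simp add: k_def)
    also have "(cmod k)\<^sup>2 * N = (cmod (h w))\<^sup>2 / N"
      using N by (simp add: k_def norm_divide power2_eq_square)
    finally have "(cmod (h w))\<^sup>2 / N \<le> 1 / Suc n"
      using v_lt[of n] by (simp add: h_def)
    thus ?thesis using N by (simp add: h_def N_def field_simps)
  qed
  have lim: "(\<lambda>n. v n w) \<longlonglongrightarrow> f w" for w
  proof -
    have "(\<lambda>n. exp ((cmod w)\<^sup>2) / Suc n) \<longlonglongrightarrow> 0"
      by (rule LIMSEQ_Suc[OF lim_const_over_n])
    hence "(\<lambda>n. (cmod (f w - v n w))\<^sup>2) \<longlonglongrightarrow> 0"
      by (rule tendsto_sandwich[OF _ _ tendsto_const, rotated 2]) (use pt in auto)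
    from tendsto_real_sqrt[OF this] have "(\<lambda>n. cmod (f w - v n w)) \<longlonglongrightarrow> 0"
      by simp
    hence "(\<lambda>n. cmod (v n w - f w)) \<longlonglongrightarrow> 0" by (simp add: norm_minus_commute)
    thus ?thesis by (rule LIM_zero_cancel[OF tendsto_norm_zero_cancel])
  qed
  have bound: "(fock_norm (\<lambda>z. f z - v n z))\<^sup>2 \<le> 4 / Suc n" for n
  proof -
    define I where "I g = (\<integral>\<^sup>+z. ennreal ((cmod (g z))\<^sup>2 * exp (- (cmod z)\<^sup>2)) \<partial>lborel)" for g
    have I: "I g = ennreal (pi * (fock_norm g)\<^sup>2)" if "g \<in> fock" for g
      unfolding I_def using fock_integrable_norm2[OF that]
      by (subst nn_integral_eq_integral) (auto simp: fock_norm_square)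
    have [measurable]: "v m \<in> borel_measurable borel" for m using v V_fock by (intro fock_measurable) auto
    have [measurable]: "f \<in> borel_measurable borel" using f by (rule fock_measurable)
    \<comment> \<open>Fatou's lemma in \<open>m\<close> with \<open>n\<close> fixed: the integrand
      for \<open>f\<close> is the pointwise limit of those for \<open>v m\<close>, and the Cauchy
      bound controls their integrals.\<close>
    have "I (\<lambda>z. f z - v n z) = (\<integral>\<^sup>+z. liminf (\<lambda>m. ennreal ((cmod (v m z - v n z))\<^sup>2 * exp (- (cmod z)\<^sup>2))) \<partial>lborel)"
      unfolding I_def
    proof (rule nn_integral_cong)
      fix z
      have "(\<lambda>m. ennreal ((cmod (v m z - v n z))\<^sup>2 * exp (- (cmod z)\<^sup>2))) \<longlonglongrightarrow>
          ennreal ((cmod (f z - v n z))\<^sup>2 * exp (- (cmod z)\<^sup>2))"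
        by (intro tendsto_intros tendsto_ennrealI lim)
      thus "ennreal ((cmod (f z - v n z))\<^sup>2 * exp (- (cmod z)\<^sup>2)) =
          liminf (\<lambda>m. ennreal ((cmod (v m z - v n z))\<^sup>2 * exp (- (cmod z)\<^sup>2)))"
        by (rule lim_imp_Liminf[OF sequentially_bot, symmetric])
    qed
    also have "\<dots> \<le> liminf (\<lambda>m. I (\<lambda>z. v m z - v n z))"
      unfolding I_def by (rule nn_integral_liminf) measurable
    also have "\<dots> \<le> limsup (\<lambda>m. I (\<lambda>z. v m z - v n z))"
      by (rule Liminf_le_Limsup) simp
    also have "\<dots> \<le> ennreal (pi * (4 / Suc n))"
    proof (rule Limsup_bounded)
      have "I (\<lambda>z. v m z - v n z) \<le> ennreal (pi * (4 / Suc n))" if "m \<ge> n" for m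
      proof -
        have "(\<lambda>z. v m z - v n z) \<in> fock" using v V_fock by (intro fock_diff) auto
        hence "I (\<lambda>z. v m z - v n z) = ennreal (pi * (fock_norm (\<lambda>z. v m z - v n z))\<^sup>2)" by (rule I)
        also have "(fock_norm (\<lambda>z. v m z - v n z))\<^sup>2 \<le> 2 / Suc n + 2 / Suc m" by (rule cauchy)
        also have "2 / real (Suc m) \<le> 2 / real (Suc n)" using that by (intro divide_left_mono) auto
        finally show ?thesis by (simp add: ennreal_leI algebra_simps)
      qed
      thus "\<forall>\<^sub>F m in sequentially. I (\<lambda>z. v m z - v n z) \<le> ennreal (pi * (4 / Suc n))"
        using eventually_sequentially by blast
    qed
    finally have "ennreal (pi * (fock_norm (\<lambda>z. f z - v n z))\<^sup>2) \<le> ennreal (pi * (4 / Suc n))"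
      unfolding I[OF fv] .
    hence "pi * (fock_norm (\<lambda>z. f z - v n z))\<^sup>2 \<le> pi * (4 / Suc n)"
      by (subst (asm) ennreal_le_iff) auto
    thus ?thesis by (rule mult_left_le_imp_le) simp
  qed
  obtain n where "4 / real (Suc n) < e\<^sup>2"
  proof -
    have "(\<lambda>n. 4 / real (Suc n)) \<longlonglongrightarrow> 0" by (rule LIMSEQ_Suc[OF lim_const_over_n])
    hence "\<forall>\<^sub>F n in sequentially. 4 / real (Suc n) < e\<^sup>2" using e by (intro order_tendstoD) auto
    thus ?thesis using that eventually_happens by (metis sequentially_bot)
  qed
  with bound[of n] have "(fock_norm (\<lambda>z. f z - v n z))\<^sup>2 < e\<^sup>2" by linarith
  hence "fock_norm (\<lambda>z. f z - v n z) < e" using e by (intro power_less_imp_less_base[of _ 2 e]) auto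
  thus ?thesis using v by blast
qed

section \<open>Weighted affine composition\<close>

lemma fock_norm_eq_0:
  assumes "f \<in> fock" "fock_norm f = 0" shows "f = (\<lambda>_. 0)"
  using fock_pointwise_bound[OF assms(1)] assms(2) by auto

text \<open>If \<open>g\<close> in \<open>D\<close> is closer to \<open>h\<close> than the norm of
  \<open>h\<close>, then orthogonality turns \<open>fock_inner h h\<close> into the inner product of
  \<open>h - g\<close> with \<open>h\<close>, which is too small. It yields uniqueness of the
  adjoint's value.\<close>

lemma fock_dense_orthogonal:
  assumes h: "h \<in> fock" and D: "D \<subseteq> fock"
    and dense: "\<And>f e. f \<in> fock \<Longrightarrow> e > 0 \<Longrightarrow> \<exists>g\<in>D. fock_norm (\<lambda>z. f z - g z) < e"
    and orth: "\<And>f. f \<in> D \<Longrightarrow> fock_inner f h = 0"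
  shows "h = (\<lambda>_. 0)"
proof (rule ccontr)
  assume "h \<noteq> (\<lambda>_. 0)"
  hence pos: "fock_norm h > 0"
    using fock_norm_eq_0[OF h] fock_norm_nonneg[of h] by (auto simp: order.strict_iff_order)
  then obtain g where g: "g \<in> D" "fock_norm (\<lambda>z. h z - g z) < fock_norm h"
    using dense[OF h] by blast
  hence gf: "g \<in> fock" using D by auto
  have "(fock_norm h)\<^sup>2 = cmod (fock_inner h h)"
    by (simp add: fock_inner_self_norm norm_power)
  also have "fock_inner h h = fock_inner (\<lambda>z. h z - g z) h"
    by (simp add: fock_inner_diff_left[OF h gf h] orth[OF g(1)])
  also have "cmod \<dots> \<le> fock_norm (\<lambda>z. h z - g z) * fock_norm h"
    by (rule fock_Cauchy_Schwarz[OF fock_diff[OF h gf] h])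
  also have "\<dots> < fock_norm h * fock_norm h"
    using g(2) pos by (intro mult_strict_right_mono)
  finally show False by (simp add: power2_eq_square)
qed

text \<open>Completing the square in the exponent, whose quadratic part is negative for
  \<open>cmod t < 1\<close>. The constant \<open>N\<close> is left free so that one value can serve
  a whole family of \<open>t\<close>.\<close>

lemma fock_exp_affine_contraction:
  assumes f: "f \<in> fock" and t: "t \<noteq> 0" "cmod t < 1"
    and N: "(cmod (t * cnj p + q))\<^sup>2 \<le> N * (1 - (cmod t)\<^sup>2)"
  shows "(\<lambda>z. exp (q * z) * f (t * z + p)) \<in> fock"
    and "(fock_norm (\<lambda>z. exp (q * z) * f (t * z + p)))\<^sup>2 \<le> exp (N + (cmod p)\<^sup>2) / (cmod t)\<^sup>2 * (fock_norm f)\<^sup>2"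
proof -
  define s where "s = t * cnj p + q"
  define \<delta> where "\<delta> = 1 - (cmod t)\<^sup>2"
  have \<delta>: "\<delta> > 0" using t by (simp add: \<delta>_def power_less_one_iff abs_square_less_1)
  have "2 * Re (s * z) - \<delta> * (cmod z)\<^sup>2 \<le> N" for z
  proof -
    have "2 * Re (s * z) \<le> 2 * (cmod s * cmod z)"
      using complex_Re_le_cmod[of "s * z"] by (simp only: norm_mult)
    hence "\<delta> * (2 * Re (s * z)) \<le> \<delta> * (2 * (cmod s * cmod z))"
      using \<delta> by (intro mult_left_mono) auto
    also have "\<dots> \<le> (cmod s)\<^sup>2 + \<delta>\<^sup>2 * (cmod z)\<^sup>2"
      using zero_le_power2[of "cmod s - \<delta> * cmod z"] by (simp add: power2_eq_square algebra_simps)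
    also have "\<dots> \<le> N * \<delta> + \<delta>\<^sup>2 * (cmod z)\<^sup>2" using N by (simp add: s_def \<delta>_def)
    finally have "\<delta> * (2 * Re (s * z) - \<delta> * (cmod z)\<^sup>2) \<le> \<delta> * N"
      by (simp add: algebra_simps power2_eq_square)
    thus ?thesis using \<delta> by (simp only: mult_le_cancel_left_pos)
  qed
  hence M: "(cmod (t * z + p))\<^sup>2 + 2 * Re (q * z) - (cmod z)\<^sup>2 \<le> N + (cmod p)\<^sup>2" for z
    unfolding cmod_affine_square s_def[symmetric] \<delta>_def[symmetric] by (smt (verit))
  show "(\<lambda>z. exp (q * z) * f (t * z + p)) \<in> fock"
    "(fock_norm (\<lambda>z. exp (q * z) * f (t * z + p)))\<^sup>2 \<le> exp (N + (cmod p)\<^sup>2) / (cmod t)\<^sup>2 * (fock_norm f)\<^sup>2"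
    using fock_exp_affine[OF f t(1) M] by blast+
qed

lemma fock_exp_affine_bounded:
  assumes t: "t \<noteq> 0" "cmod t < 1"
  obtains L where "\<And>f. f \<in> fock \<Longrightarrow> (\<lambda>z. exp (q * z) * f (t * z + p)) \<in> fock"
    "\<And>f. f \<in> fock \<Longrightarrow> fock_norm (\<lambda>z. exp (q * z) * f (t * z + p)) \<le> L * fock_norm f"
    "L \<ge> 0"
proof -
  define N where "N = (cmod (t * cnj p + q))\<^sup>2 / (1 - (cmod t)\<^sup>2)"
  have "1 - (cmod t)\<^sup>2 > 0" using t by (simp add: power_less_one_iff abs_square_less_1)
  hence N: "(cmod (t * cnj p + q))\<^sup>2 \<le> N * (1 - (cmod t)\<^sup>2)" by (simp add: N_def)
  show ?thesis
  proof (rule that[of "sqrt (exp (N + (cmod p)\<^sup>2) / (cmod t)\<^sup>2)"])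
    fix f assume f: "f \<in> fock"
    show "(\<lambda>z. exp (q * z) * f (t * z + p)) \<in> fock"
      by (rule fock_exp_affine_contraction(1)[OF f t N])
    show "fock_norm (\<lambda>z. exp (q * z) * f (t * z + p)) \<le>
        sqrt (exp (N + (cmod p)\<^sup>2) / (cmod t)\<^sup>2) * fock_norm f"
      using real_sqrt_le_mono[OF fock_exp_affine_contraction(2)[OF f t N]]
      by (simp only: real_sqrt_mult real_sqrt_abs abs_of_nonneg fock_norm_nonneg)
  qed simp
qed

text \<open>On kernels both sides are point values, since \<open>Q\<close> sends the kernel at
  \<open>w\<close> to a multiple of the kernel at \<open>t * w + p\<close>. Both sides depend
  continuously on \<open>g\<close> because the two operators are bounded, so density of the kernels
  suffices.\<close>

lemma fock_exp_affine_adjoint: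
  assumes t: "t \<noteq> 0" "cmod t < 1" and f: "f \<in> fock" and g: "g \<in> fock"
  shows "fock_inner (\<lambda>z. exp (q * z) * f (t * z + p)) g =
    fock_inner f (\<lambda>z. exp (cnj p * z) * g (cnj t * z + cnj q))"
proof -
  define F where "F = (\<lambda>z. exp (q * z) * f (t * z + p))"
  define Q where "Q g = (\<lambda>z. exp (cnj p * z) * g (cnj t * z + cnj q))" for g
  have F: "F \<in> fock" using fock_exp_affine_bounded[OF t, of q p] f unfolding F_def by metis
  obtain L where Q: "\<And>g. g \<in> fock \<Longrightarrow> Q g \<in> fock" and L: "\<And>g. g \<in> fock \<Longrightarrow> fock_norm (Q g) \<le> L * fock_norm g"
    and L0: "L \<ge> 0"
    using fock_exp_affine_bounded[of "cnj t" "cnj p" "cnj q"] t unfolding Q_def by auto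
  define V where "V = {g\<in>fock. fock_inner F g = fock_inner f (Q g)}"
  have Qadd: "Q (\<lambda>z. u z + v z) = (\<lambda>z. Q u z + Q v z)" for u v by (simp add: Q_def algebra_simps)
  have Qdiff: "Q (\<lambda>z. u z - v z) = (\<lambda>z. Q u z - Q v z)" for u v by (simp add: Q_def algebra_simps)
  have Qscale: "Q (\<lambda>z. k * u z) = (\<lambda>z. k * Q u z)" for u k by (simp add: Q_def mult_ac)
  have Qker: "Q (fock_kernel w) = (\<lambda>z. cnj (exp (q * w)) * fock_kernel (t * w + p) z)" for w
    by (simp add: Q_def fun_eq_iff exp_cnj flip: exp_add) (simp add: algebra_simps)
  have V: "fock_subspace V" unfolding fock_subspace_def
  proof (intro conjI ballI allI)
    show "V \<subseteq> fock" by (auto simp: V_def)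
    show "(\<lambda>_. 0) \<in> V"
      by (simp add: V_def fock_const Q_def) (simp add: fock_inner_def)
  next
    fix u v assume "u \<in> V" "v \<in> V"
    thus "(\<lambda>z. u z + v z) \<in> V"
      using F f by (auto simp: V_def fock_add Qadd fock_inner_add_right Q)
  next
    fix k u assume "u \<in> V"
    thus "(\<lambda>z. k * u z) \<in> V"
      by (auto simp: V_def fock_scale Qscale fock_inner_scale_right)
  qed
  have K: "fock_kernel w \<in> V" for w
  proof -
    have "fock_inner f (Q (fock_kernel w)) = F w"
      by (simp only: Qker fock_inner_scale_right fock_reproducing[OF f] complex_cnj_cnj F_def)
    thus ?thesis by (simp add: V_def fock_exp fock_reproducing[OF F])
  qed
  have "fock_inner F g - fock_inner f (Q g) = 0"
  proof (rule ccontr)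
    define d where "d = cmod (fock_inner F g - fock_inner f (Q g))"
    \<comment> \<open>A Lipschitz constant for both sides together as functions of \<open>g\<close>;
      the summand 1 keeps it positive for the division.\<close>
    define c where "c = fock_norm F + fock_norm f * L + 1"
    assume "\<not> ?thesis"
    hence d: "d > 0" by (simp add: d_def)
    have c: "c > 0"
      using fock_norm_nonneg[of F] mult_nonneg_nonneg[OF fock_norm_nonneg[of f] L0] unfolding c_def by linarith
    from fock_kernel_dense[OF V K g, of "d / c"] d c
    obtain v where v: "v \<in> V" "fock_norm (\<lambda>z. g z - v z) < d / c" by auto
    have vf: "v \<in> fock" using v by (auto simp: V_def)
    let ?h = "\<lambda>z. g z - v z"
    have h: "?h \<in> fock" by (rule fock_diff[OF g vf])
    have "fock_inner F g - fock_inner f (Q g) = fock_inner F ?h - fock_inner f (Q ?h)"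
      using v(1) by (simp add: V_def Qdiff fock_inner_diff_right F f g vf Q)
    hence "d \<le> cmod (fock_inner F ?h) + cmod (fock_inner f (Q ?h))"
      unfolding d_def by (simp add: norm_triangle_ineq4)
    also have "\<dots> \<le> fock_norm F * fock_norm ?h + fock_norm f * fock_norm (Q ?h)"
      by (intro add_mono fock_Cauchy_Schwarz F f h Q)
    also have "\<dots> \<le> fock_norm F * fock_norm ?h + fock_norm f * (L * fock_norm ?h)"
      by (intro add_mono mult_left_mono L h) auto
    also have "\<dots> \<le> c * fock_norm ?h" by (simp add: c_def algebra_simps)
    also have "\<dots> < c * (d / c)" using v(2) c by (intro mult_strict_left_mono)
    also have "\<dots> = d" using c by simp
    finally show False by simp
  qed
  thus ?thesis by (simp add: F_def Q_def)
qed

section \<open>Dilations and their limit at the boundary point 1\<close>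

text \<open>On this disc \<open>|1 - t|\<^sup>2 \<le> 1 - |t|\<^sup>2\<close>, so the dilations stay bounded up to the
  boundary point \<open>1\<close>; the factor \<open>t\<close> in \<open>dilation\<close> removes the blow-up of the norms at \<open>0\<close>.\<close>

abbreviation horodisc :: "complex set" where
  "horodisc \<equiv> ball (1/2) (1/2)"

lemma horodisc:
  assumes "t \<in> horodisc"
  shows "t \<noteq> 0" "cmod t < 1" "(cmod (1 - t))\<^sup>2 \<le> 1 - (cmod t)\<^sup>2" "cmod (1 - t) \<le> 1"
proof -
  have "(cmod (1/2 - t))\<^sup>2 < (1/2)\<^sup>2"
    using assms by (intro power_strict_mono) (auto simp: dist_norm)
  \<comment> \<open>The disc is the set where the squared modulus of \<open>t\<close> is less than
    \<open>Re t\<close>; all four claims are read off from this.\<close>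
  hence *: "(Re t)\<^sup>2 + (Im t)\<^sup>2 < Re t"
    unfolding cmod_power2 by (simp add: power2_eq_square algebra_simps)
  show "t \<noteq> 0" using * by auto
  have "Re t < 1"
  proof (rule ccontr)
    assume "\<not> Re t < 1"
    hence "Re t * Re t \<ge> Re t * 1" by (intro mult_left_mono) auto
    hence "Re t \<le> (Re t)\<^sup>2" by (simp add: power2_eq_square)
    thus False using * zero_le_power2[of "Im t"] by linarith
  qed
  hence "(cmod t)\<^sup>2 < 1" using * by (simp add: cmod_power2)
  thus "cmod t < 1" by (simp add: abs_square_less_1)
  show a: "(cmod (1 - t))\<^sup>2 \<le> 1 - (cmod t)\<^sup>2"
    unfolding cmod_power2 using * by (simp add: power2_eq_square algebra_simps)
  hence "(cmod (1 - t))\<^sup>2 \<le> 1" using zero_le_power2[of "cmod t"] by linarith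
  thus "cmod (1 - t) \<le> 1" by (simp add: abs_square_le_1)
qed

definition dilation :: "complex \<Rightarrow> complex \<Rightarrow> complex \<Rightarrow> cfun \<Rightarrow> complex \<Rightarrow> cfun" where
  "dilation k q p f t = (\<lambda>z. t * exp ((1 - t) * k) * (exp ((1 - t) * q * z) * f (t * z + (1 - t) * p)))"

text \<open>The linear coefficient of the exponent is at most \<open>cmod (1 - t)\<close> times a
  constant, so on \<open>horodisc\<close> its square is at most
  \<open>N * (1 - (cmod t)\<^sup>2)\<close> with \<open>N\<close> independent of \<open>t\<close>.
  The Jacobian factor is cancelled by the factor \<open>t\<close> of
  \<open>dilation\<close>.\<close>

lemma dilation_bounded:
  assumes f: "f \<in> fock"
  obtains L where "\<And>t. t \<in> horodisc \<Longrightarrow> dilation k q p f t \<in> fock"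
    "\<And>t. t \<in> horodisc \<Longrightarrow> fock_norm (dilation k q p f t) \<le> L" "L \<ge> 0"
proof -
  define N where "N = (cmod p + cmod q)\<^sup>2"
  define L where "L = exp (cmod k) * (sqrt (exp (N + (cmod p)\<^sup>2)) * fock_norm f)"
  have *: "dilation k q p f t \<in> fock \<and> fock_norm (dilation k q p f t) \<le> L" if t: "t \<in> horodisc" for t
  proof -
    note h = horodisc[OF t]
    have "cmod (t * cnj ((1 - t) * p) + (1 - t) * q) \<le> cmod t * (cmod (1 - t) * cmod p) + cmod (1 - t) * cmod q"
      by (rule order_trans[OF norm_triangle_ineq]) (simp only: norm_mult complex_mod_cnj order_refl)
    also have "\<dots> \<le> 1 * (cmod (1 - t) * cmod p) + cmod (1 - t) * cmod q"
      using h by (intro add_mono mult_right_mono) auto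
    finally have "(cmod (t * cnj ((1 - t) * p) + (1 - t) * q))\<^sup>2 \<le> (cmod (1 - t) * (cmod p + cmod q))\<^sup>2"
      by (intro power_mono) (auto simp: algebra_simps)
    also have "\<dots> \<le> N * (1 - (cmod t)\<^sup>2)"
      using mult_left_mono[OF h(3), of N] by (simp add: N_def power_mult_distrib mult.commute)
    finally have b: "(cmod (t * cnj ((1 - t) * p) + (1 - t) * q))\<^sup>2 \<le> N * (1 - (cmod t)\<^sup>2)" .
    define F where "F = (\<lambda>z. exp ((1 - t) * q * z) * f (t * z + (1 - t) * p))"
    have F: "F \<in> fock" unfolding F_def by (rule fock_exp_affine_contraction(1)[OF f h(1,2) b])
    have "(fock_norm F)\<^sup>2 \<le> exp (N + (cmod ((1 - t) * p))\<^sup>2) / (cmod t)\<^sup>2 * (fock_norm f)\<^sup>2"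
      unfolding F_def by (rule fock_exp_affine_contraction(2)[OF f h(1,2) b])
    also have "\<dots> \<le> exp (N + (cmod p)\<^sup>2) / (cmod t)\<^sup>2 * (fock_norm f)\<^sup>2"
    proof -
      have "cmod ((1 - t) * p) \<le> cmod p" using h(4) mult_right_mono[OF h(4), of "cmod p"] by (simp add: norm_mult)
      hence "(cmod ((1 - t) * p))\<^sup>2 \<le> (cmod p)\<^sup>2" by (intro power_mono) auto
      thus ?thesis by (intro mult_right_mono divide_right_mono) auto
    qed
    finally have "(cmod t * fock_norm F)\<^sup>2 \<le> exp (N + (cmod p)\<^sup>2) * (fock_norm f)\<^sup>2"
      using h(1) by (simp add: power_mult_distrib field_simps)
    from real_sqrt_le_mono[OF this]
    have "cmod t * fock_norm F \<le> sqrt (exp (N + (cmod p)\<^sup>2)) * fock_norm f"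
      by (simp add: real_sqrt_mult)
    moreover have "cmod (exp ((1 - t) * k)) \<le> exp (cmod k)"
    proof -
      have "Re ((1 - t) * k) \<le> cmod (1 - t) * cmod k"
        using complex_Re_le_cmod[of "(1 - t) * k"] by (simp only: norm_mult)
      also have "\<dots> \<le> cmod k" using mult_right_mono[OF h(4), of "cmod k"] by simp
      finally show ?thesis by (simp only: norm_exp_eq_Re exp_le_cancel_iff)
    qed
    ultimately have "cmod (exp ((1 - t) * k)) * (cmod t * fock_norm F) \<le> L"
      unfolding L_def by (intro mult_mono[of "cmod (exp ((1 - t) * k))" "exp (cmod k)"]) simp_all
    moreover have "dilation k q p f t = (\<lambda>z. t * exp ((1 - t) * k) * F z)"
      by (simp add: dilation_def F_def)
    ultimately show ?thesis using F
      by (simp only: fock_norm_scale fock_scale norm_mult) (simp add: mult_ac)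
  qed
  show ?thesis by (rule that[of L]) (use * in \<open>auto simp: L_def\<close>)
qed

text \<open>Against a kernel the inner product is a point value, an explicit entire function of
  \<open>t\<close> with value \<open>f w\<close> at 1. The uniform bound on the dilations makes
  approximation of \<open>g\<close> by kernel combinations uniform in \<open>t\<close>, and uniform
  limits preserve both claims.\<close>

lemma dilation_inner_limit:
  assumes f: "f \<in> fock" and g: "g \<in> fock"
  shows "(\<lambda>t. fock_inner (dilation k q p f t) g) holomorphic_on horodisc"
    and "((\<lambda>t. fock_inner (dilation k q p f t) g) \<longlongrightarrow> fock_inner f g) (at 1 within horodisc)"
proof -
  let ?F = "at 1 within horodisc"
  let ?h = "\<lambda>g t. fock_inner (dilation k q p f t) g"
  obtain L where d: "\<And>t. t \<in> horodisc \<Longrightarrow> dilation k q p f t \<in> fock"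
    and L: "\<And>t. t \<in> horodisc \<Longrightarrow> fock_norm (dilation k q p f t) \<le> L" and L0: "L \<ge> 0"
    using dilation_bounded[OF f] by blast
  define V where "V = {g\<in>fock. ?h g holomorphic_on horodisc \<and> (?h g \<longlongrightarrow> fock_inner f g) ?F}"
  have in_S: "eventually (\<lambda>t. t \<in> horodisc) ?F" by (simp add: eventually_at_filter)
  have V: "fock_subspace V" unfolding fock_subspace_def
  proof (intro conjI ballI allI)
    show "V \<subseteq> fock" by (auto simp: V_def)
    show "(\<lambda>_. 0) \<in> V" by (simp add: V_def fock_const) (simp add: fock_inner_def)
  next
    fix u v assume uv: "u \<in> V" "v \<in> V"
    have *: "?h (\<lambda>z. u z + v z) t = ?h u t + ?h v t" if "t \<in> horodisc" for t
      using uv d[OF that] by (auto simp: V_def fock_inner_add_right)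
    have "(\<lambda>t. ?h u t + ?h v t) holomorphic_on horodisc"
      using uv by (auto simp: V_def intro!: holomorphic_intros)
    hence "?h (\<lambda>z. u z + v z) holomorphic_on horodisc"
      by (rule holomorphic_transform) (simp add: *)
    moreover have "((\<lambda>t. ?h u t + ?h v t) \<longlongrightarrow> fock_inner f (\<lambda>z. u z + v z)) ?F"
      using uv f by (auto simp: V_def fock_inner_add_right intro!: tendsto_add)
    hence "(?h (\<lambda>z. u z + v z) \<longlongrightarrow> fock_inner f (\<lambda>z. u z + v z)) ?F"
      by (rule Lim_transform_eventually) (use in_S in \<open>eventually_elim, simp add: *\<close>)
    ultimately show "(\<lambda>z. u z + v z) \<in> V"
      using uv by (auto simp: V_def fock_add)
  next
    fix c u assume "u \<in> V"
    thus "(\<lambda>z. c * u z) \<in> V"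
      by (auto simp: V_def fock_scale fock_inner_scale_right intro!: holomorphic_intros tendsto_intros)
  qed
  have K: "fock_kernel w \<in> V" for w
  proof -
    let ?e = "\<lambda>t. t * exp ((1 - t) * k) * (exp ((1 - t) * q * w) * f (t * w + (1 - t) * p))"
    have *: "?h (fock_kernel w) t = ?e t" if "t \<in> horodisc" for t
      using fock_reproducing[OF d[OF that]] by (simp add: dilation_def)
    have "f \<circ> (\<lambda>t. t * w + (1 - t) * p) holomorphic_on UNIV"
      by (rule holomorphic_on_compose_gen[OF _ fock_holomorphic[OF f]]) (auto intro!: holomorphic_intros)
    hence e: "?e holomorphic_on UNIV" by (auto simp: comp_def intro!: holomorphic_intros)
    have "?h (fock_kernel w) holomorphic_on horodisc"
      by (rule holomorphic_transform[OF holomorphic_on_subset[OF e]]) (simp_all add: *)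
    moreover have "isCont ?e 1"
      using holomorphic_on_imp_continuous_on[OF e] by (simp only: continuous_on_eq_continuous_at open_UNIV) blast
    hence "(?e \<longlongrightarrow> ?e 1) (at 1)" by (rule isContD)
    hence "(?e \<longlongrightarrow> f w) (at 1)" by simp
    hence "(?e \<longlongrightarrow> f w) ?F" by (rule tendsto_within_subset) simp
    hence "(?h (fock_kernel w) \<longlongrightarrow> f w) ?F"
      by (rule Lim_transform_eventually) (use in_S in \<open>eventually_elim, simp add: *\<close>)
    ultimately show ?thesis using f by (auto simp: V_def fock_exp fock_reproducing)
  qed
  have "\<exists>v\<in>V. fock_norm (\<lambda>z. g z - v z) < 1 / real (Suc n)" for n
    by (rule fock_kernel_dense[OF V K g]) simp
  then obtain v where v: "\<And>n. v n \<in> V" and vn: "\<And>n. fock_norm (\<lambda>z. g z - v n z) < 1 / real (Suc n)"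
    by metis
  have vf: "v n \<in> fock" for n using v by (auto simp: V_def)
  have gv: "cmod (fock_inner u (v n) - fock_inner u g) \<le> fock_norm u * (1 / real (Suc n))" if u: "u \<in> fock" for u n
  proof -
    have "cmod (fock_inner u (v n) - fock_inner u g) = cmod (fock_inner u (\<lambda>z. g z - v n z))"
      by (simp add: fock_inner_diff_right[OF g vf u] norm_minus_commute)
    also have "\<dots> \<le> fock_norm u * fock_norm (\<lambda>z. g z - v n z)"
      by (intro fock_Cauchy_Schwarz u fock_diff g vf)
    also have "\<dots> \<le> fock_norm u * (1 / real (Suc n))"
      using vn[of n] by (intro mult_left_mono) auto
    finally show ?thesis .
  qed
  have null: "(\<lambda>n. c * (1 / real (Suc n))) \<longlonglongrightarrow> 0" for c
    using tendsto_mult[OF tendsto_const[of c] LIMSEQ_Suc[OF lim_const_over_n[of 1]]] by simp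
  have ul: "uniform_limit horodisc (\<lambda>n. ?h (v n)) (?h g) sequentially"
  proof (rule uniform_limitI)
    fix e :: real assume e: "e > 0"
    have "eventually (\<lambda>n. L * (1 / real (Suc n)) < e) sequentially"
      using null[of L] e by (rule order_tendstoD)
    thus "\<forall>\<^sub>F n in sequentially. \<forall>t\<in>horodisc. dist (?h (v n) t) (?h g t) < e"
    proof eventually_elim
      case (elim n)
      show ?case
      proof
        fix t assume t: "t \<in> horodisc"
        have "dist (?h (v n) t) (?h g t) \<le> fock_norm (dilation k q p f t) * (1 / real (Suc n))"
          unfolding dist_norm by (rule gv[OF d[OF t]])
        also have "\<dots> \<le> L * (1 / real (Suc n))" using L[OF t] by (intro mult_right_mono) auto
        finally show "dist (?h (v n) t) (?h g t) < e" using elim by simp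
      qed
    qed
  qed
  show "?h g holomorphic_on horodisc"
  proof (rule holomorphic_uniform_sequence)
    show "?h (v n) holomorphic_on horodisc" for n using v by (auto simp: V_def)
    fix t assume "t \<in> horodisc"
    then obtain e where "e > 0" "cball t e \<subseteq> horodisc"
      using open_ball open_contains_cball by blast
    thus "\<exists>e>0. cball t e \<subseteq> horodisc \<and> uniform_limit (cball t e) (\<lambda>n. ?h (v n)) (?h g) sequentially"
      using uniform_limit_on_subset[OF ul] by blast
  qed simp
  show "(?h g \<longlongrightarrow> fock_inner f g) ?F"
  proof (rule swap_uniform_limit[OF _ _ ul])
    show "\<forall>\<^sub>F n in sequentially. (?h (v n) \<longlongrightarrow> fock_inner f (v n)) ?F"
      using v by (auto simp: V_def)
    have "(\<lambda>n. fock_inner f (v n) - fock_inner f g) \<longlonglongrightarrow> 0"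
      by (rule Lim_null_comparison[OF _ null[of "fock_norm f"]]) (use gv[OF f] in auto)
    thus "(\<lambda>n. fock_inner f (v n)) \<longlonglongrightarrow> fock_inner f g" by (rule LIM_zero_cancel)
  qed simp
qed

text \<open>With \<open>R\<close> the plain dilation by \<open>t\<close> and \<open>Q\<close> the twisted one in \<open>h2\<close>, \<open>R T = T Q\<close>.\<close>

lemma fock_exp_affine_max_adjoint:
  assumes u: "u \<in> fock" and g: "g \<in> fock"
    and Tu: "(\<lambda>z. exp (D * z) * u (A * z + B)) \<in> fock"
    and Sg: "(\<lambda>z. exp (cnj B * z) * g (cnj A * z + cnj D)) \<in> fock"
  shows "fock_inner (\<lambda>z. exp (D * z) * u (A * z + B)) g =
    fock_inner u (\<lambda>z. exp (cnj B * z) * g (cnj A * z + cnj D))"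
\<comment> \<open>The twisted dilation divides by \<open>A\<close>. For \<open>A = 0\<close> both
  operators have rank at most one, and the reproducing property suffices.\<close>
proof (cases "A = 0")
  case True
  have "fock_inner (\<lambda>z. exp (D * z) * u B) g = u B * fock_inner (fock_kernel (cnj D)) g"
    by (simp add: fock_inner_scale_left[symmetric] mult.commute)
  moreover have "fock_inner u (\<lambda>z. exp (cnj B * z) * g (cnj D)) = cnj (g (cnj D)) * fock_inner u (fock_kernel B)"
    by (simp add: fock_inner_scale_right[symmetric] mult.commute)
  ultimately show ?thesis
    using True fock_kernel_reproducing[OF g, of "cnj D"] by (simp add: fock_reproducing[OF u])
next
  case False
  define T where "T = (\<lambda>z. exp (D * z) * u (A * z + B))"
  define S where "S = (\<lambda>z. exp (cnj B * z) * g (cnj A * z + cnj D))"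
  have TS: "T \<in> fock" "S \<in> fock" using Tu Sg by (simp_all add: T_def S_def)
  define h1 where "h1 t = fock_inner (dilation 0 0 0 T t) g" for t
  \<comment> \<open>The parameters make the twisted dilation compatible with \<open>T\<close>:
    substituting \<open>A * z + B\<close> sends \<open>t * z + (1 - t) * B\<close> to
    \<open>A * t * z + B\<close>, and the exponential factors combine to
    \<open>exp (D * t * z)\<close>.\<close>
  define h2 where "h2 t = fock_inner (dilation (D * B / A) (- D / A) B u t) S" for t
  \<comment> \<open>On \<open>s\<close> also \<open>cmod (A * t) < 1\<close>, so the dilated
    operator is bounded and the adjoint formula for contractions applies on both sides.\<close>
  define s where "s = horodisc \<inter> ball 0 (1 / cmod A)"
  have eq_small: "h1 t = h2 t" if "t \<in> s" for t
  proof -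
    have t: "t \<in> horodisc" and "cmod t < 1 / cmod A" using that by (auto simp: s_def)
    note h = horodisc[OF t]
    have At: "A * t \<noteq> 0" "cmod (A * t) < 1"
      using False h \<open>cmod t < 1 / cmod A\<close> by (auto simp: norm_mult field_simps)
    define G where "G = (\<lambda>z. exp (cnj B * z) * g (cnj (A * t) * z + cnj (D * t)))"
    have "dilation 0 0 0 T t = (\<lambda>z. t * (exp (D * t * z) * u (A * t * z + B)))"
      by (simp add: dilation_def T_def mult_ac)
    hence 1: "h1 t = t * fock_inner u G"
      by (simp add: h1_def fock_inner_scale_left fock_exp_affine_adjoint[OF At u g] G_def)
    define e where "e = exp ((1 - t) * (D * B / A))"
    have e: "e \<noteq> 0" by (simp add: e_def)
    have "h2 t = t * e * fock_inner (\<lambda>z. exp ((1 - t) * (- D / A) * z) * u (t * z + (1 - t) * B)) S"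
      by (simp only: h2_def dilation_def e_def fock_inner_scale_left)
    also have "fock_inner (\<lambda>z. exp ((1 - t) * (- D / A) * z) * u (t * z + (1 - t) * B)) S =
       fock_inner u (\<lambda>z. exp (cnj ((1 - t) * B) * z) * S (cnj t * z + cnj ((1 - t) * (- D / A))))"
      by (rule fock_exp_affine_adjoint[OF h(1,2) u TS(2)])
    also have "(\<lambda>z. exp (cnj ((1 - t) * B) * z) * S (cnj t * z + cnj ((1 - t) * (- D / A)))) =
       (\<lambda>z. cnj (1 / e) * G z)"
    proof
      fix z
      have "cnj A * (cnj t * z + cnj ((1 - t) * (- D / A))) + cnj D = cnj (A * t) * z + cnj (D * t)"
        using False by (simp add: field_simps)
      moreover have "exp (cnj ((1 - t) * B) * z) * exp (cnj B * (cnj t * z + cnj ((1 - t) * (- D / A))))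
          = cnj (1 / e) * exp (cnj B * z)"
      proof -
        have "1 / e = exp (- ((1 - t) * (D * B / A)))" by (simp add: e_def exp_minus field_simps)
        hence "cnj (1 / e) = exp (cnj (- ((1 - t) * (D * B / A))))" by (simp only: exp_cnj)
        moreover have "cnj ((1 - t) * B) * z + cnj B * (cnj t * z + cnj ((1 - t) * (- D / A))) =
            cnj (- ((1 - t) * (D * B / A))) + cnj B * z"
          by (simp add: algebra_simps)
        ultimately show ?thesis by (simp only: exp_add[symmetric])
      qed
      ultimately show "exp (cnj ((1 - t) * B) * z) * S (cnj t * z + cnj ((1 - t) * (- D / A))) = cnj (1 / e) * G z"
        unfolding S_def G_def by (simp only: mult.assoc[symmetric])
    qed
    finally have "h2 t = t * fock_inner u G" using e by (simp only: fock_inner_scale_right) simp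
    with 1 show ?thesis by simp
  qed
  have hol: "h1 holomorphic_on horodisc" "h2 holomorphic_on horodisc"
    unfolding h1_def h2_def by (intro dilation_inner_limit u g TS)+
  \<comment> \<open>Small positive reals lie in both discs, so analytic continuation has an open set
    to start from.\<close>
  have "s \<noteq> {}"
  proof -
    define r where "r = min (1/2) (1 / (2 * cmod A))"
    have "0 < r" "r \<le> 1/2" "r < 1 / cmod A" using False by (auto simp: r_def min_def field_simps)
    moreover have "1/2 - complex_of_real r = complex_of_real (1/2 - r)" by simp
    hence "dist (1/2) (complex_of_real r) = \<bar>1/2 - r\<bar>" by (simp only: dist_norm norm_of_real)
    ultimately have "complex_of_real r \<in> s" by (simp add: s_def)
    thus ?thesis by auto
  qed
  hence eq: "h1 t = h2 t" if "t \<in> horodisc" for t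
    using analytic_continuation_open[of s horodisc h1 h2 t] hol eq_small that by (auto simp: s_def)
  have lim1: "(h1 \<longlongrightarrow> fock_inner T g) (at 1 within horodisc)"
    unfolding h1_def by (intro dilation_inner_limit g TS)
  have "(h2 \<longlongrightarrow> fock_inner u S) (at 1 within horodisc)"
    unfolding h2_def by (intro dilation_inner_limit u TS)
  hence "(h1 \<longlongrightarrow> fock_inner u S) (at 1 within horodisc)"
    by (rule Lim_transform_eventually) (auto simp: eventually_at_filter eq)
  moreover have "at 1 within horodisc \<noteq> bot"
    unfolding trivial_limit_within by (simp add: islimpt_ball dist_norm)
  ultimately have "fock_inner T g = fock_inner u S" using lim1 tendsto_unique by blast
  thus ?thesis by (simp add: T_def S_def)
qed

section \<open>Selfadjointness\<close>

text \<open>Two representing elements differ by something orthogonal to the dense domain, so the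
  definite description in \<open>adjoint_op\<close> is well defined.\<close>

lemma adjoint_op_Some_iff:
  assumes dense: "densely_defined T" and dom: "dom T \<subseteq> fock"
  shows "adjoint_op T g = Some h \<longleftrightarrow>
    g \<in> fock \<and> h \<in> fock \<and> (\<forall>f\<in>dom T. fock_inner (the (T f)) g = fock_inner f h)"
proof -
  let ?P = "\<lambda>h. h \<in> fock \<and> (\<forall>f\<in>dom T. fock_inner (the (T f)) g = fock_inner f h)"
  have uniq: "h' = h''" if "?P h'" "?P h''" for h' h''
  proof -
    have "(\<lambda>z. h' z - h'' z) = (\<lambda>_. 0)"
    proof (rule fock_dense_orthogonal[OF _ dom])
      show "(\<lambda>z. h' z - h'' z) \<in> fock" using that by (auto intro: fock_diff)
      show "\<exists>g\<in>dom T. fock_norm (\<lambda>z. f z - g z) < e" if "f \<in> fock" "e > 0" for f e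
        using dense that by (auto simp: densely_defined_def)
      show "fock_inner f (\<lambda>z. h' z - h'' z) = 0" if "f \<in> dom T" for f
        using \<open>?P h'\<close> \<open>?P h''\<close> that dom by (simp add: fock_inner_diff_right subset_iff)
    qed
    thus ?thesis by (simp add: fun_eq_iff)
  qed
  have the: "(THE h. ?P h) = h'" if "?P h'" for h' using that uniq by (intro the_equality) blast+
  show ?thesis
  proof
    assume A: "adjoint_op T g = Some h"
    then obtain h' where h': "g \<in> fock" "?P h'"
      unfolding adjoint_op_def by (auto split: if_split_asm)
    with A have "h = (THE h. ?P h)" unfolding adjoint_op_def by (auto split: if_split_asm)
    with the[OF h'(2)] h' show "g \<in> fock \<and> ?P h" by simp
  next
    assume A: "g \<in> fock \<and> ?P h"
    hence "adjoint_op T g = Some (THE h. ?P h)" unfolding adjoint_op_def by auto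
    with the[of h] A show "adjoint_op T g = Some h" by simp
  qed
qed

lemma wcomp_max_Some_iff:
  "wcomp_max \<psi> \<phi> f = Some h \<longleftrightarrow> f \<in> fock \<and> h \<in> fock \<and> h = wcomp_expr \<psi> \<phi> f"
  by (auto simp: wcomp_max_def)

lemma dom_wcomp_max: "dom (wcomp_max \<psi> \<phi>) = {f\<in>fock. wcomp_expr \<psi> \<phi> f \<in> fock}"
  by (auto simp: wcomp_max_def dom_def)

lemma the_wcomp_max: "f \<in> dom (wcomp_max \<psi> \<phi>) \<Longrightarrow> the (wcomp_max \<psi> \<phi> f) = wcomp_expr \<psi> \<phi> f"
  by (auto simp: wcomp_max_def split: if_split_asm)

lemma wcomp_expr_add: "wcomp_expr \<psi> \<phi> (\<lambda>z. f z + g z) = (\<lambda>z. wcomp_expr \<psi> \<phi> f z + wcomp_expr \<psi> \<phi> g z)"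
  by (simp add: wcomp_expr_def algebra_simps)

lemma wcomp_expr_scale: "wcomp_expr \<psi> \<phi> (\<lambda>z. k * f z) = (\<lambda>z. k * wcomp_expr \<psi> \<phi> f z)"
  by (simp add: wcomp_expr_def algebra_simps)

lemma fock_subspace_dom_wcomp_max: "fock_subspace (dom (wcomp_max \<psi> \<phi>))"
  unfolding fock_subspace_def dom_wcomp_max
  by (auto simp: wcomp_expr_add wcomp_expr_scale fock_add fock_scale fock_const)
    (simp add: wcomp_expr_def fock_const)

lemma linear_op_wcomp_max: "linear_op (wcomp_max \<psi> \<phi>)"
proof -
  have "ran (wcomp_max \<psi> \<phi>) \<subseteq> fock" by (auto simp: ran_def wcomp_max_Some_iff)
  thus ?thesis
    using fock_subspace_dom_wcomp_max[of \<psi> \<phi>]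
    by (simp add: linear_op_def the_wcomp_max wcomp_expr_add wcomp_expr_scale fock_subspace_def)
qed

lemma fock_norm_tendsto_pointwise:
  assumes "\<And>n. X n \<in> fock" "f \<in> fock" "(\<lambda>n. fock_norm (\<lambda>z. X n z - f z)) \<longlonglongrightarrow> 0"
  shows "(\<lambda>n. X n w) \<longlonglongrightarrow> f w"
proof -
  have "(\<lambda>n. X n w - f w) \<longlonglongrightarrow> 0"
  proof (rule Lim_null_comparison)
    show "(\<lambda>n. fock_norm (\<lambda>z. X n z - f z) * fock_norm (fock_kernel w)) \<longlonglongrightarrow> 0"
      using tendsto_mult_right[OF assms(3), of "fock_norm (fock_kernel w)"] by simp
    show "\<forall>\<^sub>F n in sequentially. cmod (X n w - f w) \<le> fock_norm (\<lambda>z. X n z - f z) * fock_norm (fock_kernel w)"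
      using fock_pointwise_bound[OF fock_diff[OF assms(1,2)]] by simp
  qed
  thus ?thesis by (rule LIM_zero_cancel)
qed

text \<open>Norm convergence implies pointwise convergence, both of \<open>X n\<close> and of its
  images, and the weighted composition is continuous for pointwise limits. Membership of the limit
  in the domain is then automatic by maximality.\<close>

lemma closed_op_wcomp_max: "closed_op (wcomp_max \<psi> \<phi>)"
  unfolding closed_op_def
proof (intro allI ballI impI, elim conjE)
  fix X f g
  assume f: "f \<in> fock" and g: "g \<in> fock" and X: "\<forall>n::nat. X n \<in> dom (wcomp_max \<psi> \<phi>)"
    and Xf: "(\<lambda>n. fock_norm (\<lambda>z. X n z - f z)) \<longlonglongrightarrow> 0"
    and Xg: "(\<lambda>n. fock_norm (\<lambda>z. the (wcomp_max \<psi> \<phi> (X n)) z - g z)) \<longlonglongrightarrow> 0"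
  have Xn: "X n \<in> fock" "wcomp_expr \<psi> \<phi> (X n) \<in> fock" for n using X by (auto simp: dom_wcomp_max)
  have "g w = wcomp_expr \<psi> \<phi> f w" for w
  proof (rule LIMSEQ_unique)
    show "(\<lambda>n. wcomp_expr \<psi> \<phi> (X n) w) \<longlonglongrightarrow> g w"
      using Xg X by (intro fock_norm_tendsto_pointwise Xn g) (simp add: the_wcomp_max)
    show "(\<lambda>n. wcomp_expr \<psi> \<phi> (X n) w) \<longlonglongrightarrow> wcomp_expr \<psi> \<phi> f w"
      unfolding wcomp_expr_def
      by (intro tendsto_intros fock_norm_tendsto_pointwise Xn f Xf)
  qed
  thus "wcomp_max \<psi> \<phi> f = Some g" using f g by (simp add: wcomp_max_Some_iff fun_eq_iff)
qed

lemma fock_cnj: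
  assumes f: "f \<in> fock" shows "(\<lambda>z. cnj (f (cnj z))) \<in> fock"
proof -
  have "range cnj = UNIV" by (metis surjI complex_cnj_cnj)
  hence "(cnj \<circ> f \<circ> cnj) holomorphic_on UNIV"
    using fock_holomorphic[OF f] by (intro holomorphic_on_compose_cnj_cnj) auto
  hence "(\<lambda>z. cnj (f (cnj z))) holomorphic_on UNIV" by (simp add: comp_def)
  thus ?thesis
    using integrable_complex_cnj[OF fock_integrable_norm2[OF f]] by (simp add: fock_def)
qed

section \<open>The weighted composition conjugation\<close>

context
  fixes a b c :: complex
  assumes a: "cmod a = 1" and ab: "cnj a * b + cnj b = 0" and c: "(cmod c)\<^sup>2 * exp ((cmod b)\<^sup>2) = 1"
begin

lemma a_cnj_a: "a * cnj a = 1"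
  using a complex_norm_square[of a] by simp

lemma a_cnj_b: "a * cnj b = - b"
proof -
  have "a * (cnj a * b + cnj b) = 0" using ab by simp
  hence "(a * cnj a) * b + a * cnj b = 0" by (simp add: algebra_simps)
  thus ?thesis using a_cnj_a by (simp add: eq_neg_iff_add_eq_0 add.commute)
qed

text \<open>The conjugation is \<open>f\<close> reflected to \<open>cnj (f (cnj z))\<close>,
  followed by an affine substitution with \<open>cmod a = 1\<close> whose linear coefficient
  \<open>a * cnj b + b\<close> vanishes.\<close>

lemma wcomp_conj_fock: assumes f: "f \<in> fock" shows "wcomp_conj a b c f \<in> fock"
proof -
  have "(\<lambda>z. exp (b * z) * (\<lambda>z. cnj (f (cnj z))) (a * z + b)) \<in> fock"
    by (rule fock_exp_affine(1)[OF fock_cnj[OF f], where M = "(cmod b)\<^sup>2"])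
      (use a in force, simp only: cmod_affine_square, simp add: a_cnj_b a)
  from fock_scale[OF this, of c] show ?thesis by (simp add: wcomp_conj_def mult.assoc)
qed

text \<open>The relations for \<open>a\<close> and \<open>b\<close> make the two substitutions
  cancel and leave the constant exponent \<open>(cmod b)\<^sup>2\<close>, which the normalisation of
  \<open>c\<close> removes.\<close>

lemma wcomp_conj_involutive: "wcomp_conj a b c (wcomp_conj a b c f) = f"
proof
  fix z
  have 1: "cnj (a * cnj (a * z + b) + b) = z"
  proof -
    have "cnj (a * cnj (a * z + b) + b) = (a * cnj a) * z + (cnj a * b + cnj b)"
      by (simp add: algebra_simps)
    thus ?thesis by (simp add: a_cnj_a ab)
  qed
  have "b * z + cnj b * (a * z + b) = (b + a * cnj b) * z + b * cnj b" by (simp add: algebra_simps)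
  hence "b * z + cnj b * (a * z + b) = complex_of_real ((cmod b)\<^sup>2)"
    by (simp only: a_cnj_b complex_norm_square) simp
  hence 2: "exp (b * z) * exp (cnj b * (a * z + b)) = complex_of_real (exp ((cmod b)\<^sup>2))"
    by (simp only: exp_add[symmetric] exp_of_real)
  have "wcomp_conj a b c (wcomp_conj a b c f) z =
      (c * cnj c) * (exp (b * z) * exp (cnj b * (a * z + b))) * f (cnj (a * cnj (a * z + b) + b))"
    by (simp add: wcomp_conj_def exp_cnj mult_ac)
  also have "\<dots> = complex_of_real ((cmod c)\<^sup>2 * exp ((cmod b)\<^sup>2)) * f z"
    by (simp only: 1 2 complex_norm_square of_real_mult)
  finally show "wcomp_conj a b c (wcomp_conj a b c f) z = f z" by (simp only: c) simp
qed

section \<open>Affine symbols: the maximal operator is selfadjoint\<close>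

context
  fixes A B C D :: complex and \<psi> \<phi> :: cfun
  assumes C: "C \<noteq> 0" and D: "D = a * B - b * A + b"
    and \<phi>: "\<And>z. \<phi> z = A * z + B" and \<psi>: "\<And>z. \<psi> z = C * exp (D * z)"
begin

text \<open>The conjugation intertwines the operator with its formal adjoint. The relation for
  \<open>D\<close> enters in the form \<open>a * cnj D = cnj B + b * cnj A - b\<close>, which
  matches both the arguments of \<open>f\<close> and the exponents.\<close>

lemma wcomp_conj_wcomp_expr:
  "wcomp_conj a b c (wcomp_expr \<psi> \<phi> f) =
    (\<lambda>z. cnj C * (exp (cnj B * z) * wcomp_conj a b c f (cnj A * z + cnj D)))"
proof
  fix z
  have "a * cnj D = (a * cnj a) * cnj B - (a * cnj b) * cnj A + a * cnj b"
    by (simp add: D algebra_simps)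
  hence aD: "a * cnj D = cnj B + b * cnj A - b" by (simp add: a_cnj_a a_cnj_b)
  have "a * (cnj A * z + cnj D) + b = a * cnj A * z + a * cnj D + b" by (simp add: algebra_simps)
  also have "\<dots> = cnj A * (a * z + b) + cnj B" unfolding aD by (simp add: algebra_simps)
  finally have "cnj (a * (cnj A * z + cnj D) + b) = cnj (cnj A * (a * z + b) + cnj B)" by (rule arg_cong)
  hence 1: "A * cnj (a * z + b) + B = cnj (a * (cnj A * z + cnj D) + b)"
    by (simp only: complex_cnj_add complex_cnj_mult complex_cnj_cnj)
  have "b * z + cnj D * (a * z + b) = b * z + (a * cnj D) * z + b * cnj D" by (simp add: algebra_simps)
  also have "\<dots> = cnj B * z + b * (cnj A * z + cnj D)" unfolding aD by (simp add: algebra_simps)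
  finally have 2: "exp (b * z) * exp (cnj D * (a * z + b)) = exp (cnj B * z) * exp (b * (cnj A * z + cnj D))"
    by (simp only: exp_add[symmetric])
  have "wcomp_conj a b c (wcomp_expr \<psi> \<phi> f) z =
      c * cnj C * (exp (b * z) * exp (cnj D * (a * z + b))) * cnj (f (A * cnj (a * z + b) + B))"
    by (simp add: wcomp_conj_def wcomp_expr_def \<phi> \<psi> exp_cnj mult_ac)
  also have "\<dots> = c * cnj C * (exp (cnj B * z) * exp (b * (cnj A * z + cnj D))) *
      cnj (f (cnj (a * (cnj A * z + cnj D) + b)))"
    by (simp only: 1 2)
  finally show "wcomp_conj a b c (wcomp_expr \<psi> \<phi> f) z =
      cnj C * (exp (cnj B * z) * wcomp_conj a b c f (cnj A * z + cnj D))"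
    by (simp only: wcomp_conj_def mult_ac)
qed

lemma wcomp_max_symmetric:
  assumes u: "u \<in> dom (wcomp_max \<psi> \<phi>)" and f: "f \<in> dom (wcomp_max \<psi> \<phi>)"
  shows "fock_inner (wcomp_expr \<psi> \<phi> u) (wcomp_conj a b c f) =
    fock_inner u (wcomp_conj a b c (wcomp_expr \<psi> \<phi> f))"
proof -
  define T where "T = (\<lambda>z. exp (D * z) * u (A * z + B))"
  define g where "g = wcomp_conj a b c f"
  define S where "S = (\<lambda>z. exp (cnj B * z) * g (cnj A * z + cnj D))"
  have uf: "u \<in> fock" "wcomp_expr \<psi> \<phi> u \<in> fock" "f \<in> fock" "wcomp_expr \<psi> \<phi> f \<in> fock"
    using u f by (auto simp: dom_wcomp_max)
  have Tu: "wcomp_expr \<psi> \<phi> u = (\<lambda>z. C * T z)"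
    by (simp add: wcomp_expr_def \<phi> \<psi> T_def mult.assoc)
  have Sg: "wcomp_conj a b c (wcomp_expr \<psi> \<phi> f) = (\<lambda>z. cnj C * S z)"
    by (simp add: wcomp_conj_wcomp_expr S_def g_def)
  have T: "T \<in> fock" using fock_scale[OF uf(2), of "1 / C"] C by (simp add: Tu)
  have S: "S \<in> fock"
    using fock_scale[OF wcomp_conj_fock[OF uf(4)], of "1 / cnj C"] C by (simp add: Sg)
  have "fock_inner T g = fock_inner u S"
    unfolding T_def S_def
    by (rule fock_exp_affine_max_adjoint)
      (use T S uf wcomp_conj_fock in \<open>simp_all add: T_def S_def g_def\<close>)
  thus ?thesis unfolding Tu Sg g_def[symmetric] fock_inner_scale_left fock_inner_scale_right by simp
qed

text \<open>Kernels go to multiples of kernels, so the maximal domain contains all of them and is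
  dense.\<close>

lemma wcomp_expr_fock_kernel:
  "wcomp_expr \<psi> \<phi> (fock_kernel w) = (\<lambda>z. C * exp (B * cnj w) * fock_kernel (cnj D + cnj A * w) z)"
  by (simp add: wcomp_expr_def \<phi> \<psi> fun_eq_iff mult.assoc flip: exp_add) (simp add: algebra_simps)

lemma fock_kernel_in_dom: "fock_kernel w \<in> dom (wcomp_max \<psi> \<phi>)"
proof -
  have "wcomp_expr \<psi> \<phi> (fock_kernel w) \<in> fock"
    unfolding wcomp_expr_fock_kernel by (intro fock_scale fock_exp)
  thus ?thesis by (simp add: dom_wcomp_max fock_exp)
qed

lemma densely_defined_wcomp_max: "densely_defined (wcomp_max \<psi> \<phi>)"
  unfolding densely_defined_def
  using fock_kernel_dense[OF fock_subspace_dom_wcomp_max fock_kernel_in_dom] by blast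

lemma wcomp_max_C_selfadjoint: "C_selfadjoint (wcomp_conj a b c) (wcomp_max \<psi> \<phi>)"
proof -
  let ?J = "wcomp_conj a b c" and ?T = "wcomp_max \<psi> \<phi>" and ?E = "wcomp_expr \<psi> \<phi>"
  have dom: "dom ?T \<subseteq> fock" by (auto simp: dom_wcomp_max)
  note adj = adjoint_op_Some_iff[OF densely_defined_wcomp_max dom]
  have "?T f = conj_by ?J (adjoint_op ?T) f" for f
  proof (cases "f \<in> fock")
    case False
    thus ?thesis by (simp add: conj_by_def wcomp_max_def)
  next
    case f: True
    show ?thesis
    proof (cases "f \<in> dom ?T")
      case True
      hence Ef: "?E f \<in> fock" by (simp add: dom_wcomp_max)
      have "adjoint_op ?T (?J f) = Some (?J (?E f))"
        unfolding adj using f Ef True by (auto simp: wcomp_conj_fock the_wcomp_max wcomp_max_symmetric)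
      thus ?thesis using f Ef by (simp add: conj_by_def wcomp_conj_involutive wcomp_max_def)
    next
      case False
      \<comment> \<open>If the adjoint had a value \<open>h\<close>, testing on kernels would
        identify it pointwise as \<open>?J (?E f)\<close>; applying the involution puts
        \<open>?E f\<close> into \<open>fock\<close> and \<open>f\<close> into the domain.\<close>
      have "adjoint_op ?T (?J f) = None"
      proof (rule ccontr)
        assume "adjoint_op ?T (?J f) \<noteq> None"
        then obtain h where "adjoint_op ?T (?J f) = Some h" by auto
        hence h: "?J f \<in> fock" "h \<in> fock"
          "\<And>u. u \<in> dom ?T \<Longrightarrow> fock_inner (the (?T u)) (?J f) = fock_inner u h"
          by (auto simp: adj)
        have "h w = ?J (?E f) w" for w
        proof -
          have "cnj (h w) = fock_inner (?E (fock_kernel w)) (?J f)"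
            using h(3)[OF fock_kernel_in_dom, of w]
            by (simp only: the_wcomp_max[OF fock_kernel_in_dom] fock_kernel_reproducing[OF h(2)])
          also have "\<dots> = C * exp (B * cnj w) * cnj (?J f (cnj D + cnj A * w))"
            by (simp only: wcomp_expr_fock_kernel fock_inner_scale_left fock_kernel_reproducing[OF h(1)])
          finally have "cnj (cnj (h w)) = cnj C * (exp (cnj B * w) * ?J f (cnj A * w + cnj D))"
            by (simp add: exp_cnj mult_ac add.commute)
          thus ?thesis by (simp add: wcomp_conj_wcomp_expr)
        qed
        hence "h = ?J (?E f)" by auto
        hence "?E f = ?J h" by (simp add: wcomp_conj_involutive)
        hence "?E f \<in> fock" using wcomp_conj_fock[OF h(2)] by simp
        thus False using f False by (simp add: dom_wcomp_max)
      qed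
      thus ?thesis using False by (auto simp: conj_by_def)
    qed
  qed
  thus ?thesis
    unfolding C_selfadjoint_def
    using closed_op_wcomp_max densely_defined_wcomp_max linear_op_wcomp_max by blast
qed

end

section \<open>The functional equation and its solutions\<close>

text \<open>Every kernel lies in the domain of the adjoint by the reproducing property alone.
  Selfadjointness therefore puts the conjugated kernels into \<open>V\<close> and prescribes their
  images; comparing values at \<open>w\<close> gives the equation.\<close>

lemma C_selfadjoint_wcomp_equation:
  assumes sa: "C_selfadjoint (wcomp_conj a b c) W" and W: "W = wcomp_max \<psi> \<phi> |` V"
    and V: "V \<subseteq> dom (wcomp_max \<psi> \<phi>)"
  shows "\<psi> w * exp (b * \<phi> w + z * (a * \<phi> w + b)) = \<psi> z * exp (b * w + \<phi> z * (a * w + b))"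
proof -
  let ?J = "wcomp_conj a b c"
  have dense: "densely_defined W" and self: "W = conj_by ?J (adjoint_op W)"
    using sa by (auto simp: C_selfadjoint_def)
  have domW: "dom W = V" using W V by auto
  have theW: "the (W f) = wcomp_expr \<psi> \<phi> f" if "f \<in> V" for f
    using that V the_wcomp_max[of f \<psi> \<phi>] by (auto simp: W)
  have Vf: "f \<in> fock" "wcomp_expr \<psi> \<phi> f \<in> fock" if "f \<in> V" for f using that V by (auto simp: dom_wcomp_max)
  have dom: "dom W \<subseteq> fock" using Vf by (auto simp: domW)
  have "adjoint_op W (fock_kernel z) = Some (\<lambda>x. cnj (\<psi> z) * fock_kernel (\<phi> z) x)"
    unfolding adjoint_op_Some_iff[OF dense dom]
  proof (intro conjI ballI)
    fix f assume "f \<in> dom W"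
    hence f: "f \<in> V" by (simp add: domW)
    show "fock_inner (the (W f)) (fock_kernel z) = fock_inner f (\<lambda>x. cnj (\<psi> z) * fock_kernel (\<phi> z) x)"
      by (simp only: theW[OF f] fock_reproducing[OF Vf(2)[OF f]] fock_inner_scale_right
          fock_reproducing[OF Vf(1)[OF f]] complex_cnj_cnj) (simp add: wcomp_expr_def)
  qed (intro fock_exp fock_scale)+
  hence Some: "W (?J (fock_kernel z)) = Some (?J (\<lambda>x. cnj (\<psi> z) * fock_kernel (\<phi> z) x))"
    by (subst self) (simp add: conj_by_def wcomp_conj_fock fock_exp wcomp_conj_involutive)
  moreover from Some have "?J (fock_kernel z) \<in> V" using domW by blast
  ultimately have "wcomp_expr \<psi> \<phi> (?J (fock_kernel z)) = ?J (\<lambda>x. cnj (\<psi> z) * fock_kernel (\<phi> z) x)"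
    using theW by fastforce
  from fun_cong[OF this, of w]
  have "c * (\<psi> w * (exp (b * \<phi> w) * exp (z * (a * \<phi> w + b)))) =
      c * (\<psi> z * (exp (b * w) * exp (\<phi> z * (a * w + b))))"
    by (simp add: wcomp_expr_def wcomp_conj_def exp_cnj mult_ac)
  moreover have "c \<noteq> 0" using c by auto
  ultimately show ?thesis by (simp add: exp_add)
qed

end

lemma wcomp_equation_solution:
  fixes \<psi> \<phi> :: cfun
  assumes hol: "\<phi> holomorphic_on UNIV" and nz: "\<exists>z. \<psi> z \<noteq> 0" and a: "a \<noteq> 0"
    and eq: "\<And>z w. \<psi> w * exp (b * \<phi> w + z * (a * \<phi> w + b)) = \<psi> z * exp (b * w + \<phi> z * (a * w + b))"
  shows "\<exists>A B C D. C \<noteq> 0 \<and> D = a * B - b * A + b \<and>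
        (\<forall>z. \<phi> z = A * z + B) \<and> (\<forall>z. \<psi> z = C * exp (D * z))"
proof -
  define B where "B = \<phi> 0"
  define A where "A = \<phi> 1 - B"
  have p0: "\<psi> 0 \<noteq> 0"
  proof
    assume "\<psi> 0 = 0"
    hence "\<psi> w = 0" for w using eq[of w 0] by simp
    thus False using nz by auto
  qed
  have psi: "\<psi> w = \<psi> 0 * exp (b * w + B * (a * w + b) - b * \<phi> w)" for w
    using eq[of w 0] by (simp add: B_def exp_diff field_simps)
  \<comment> \<open>The difference of the two exponents at \<open>z = 1\<close>, after
    \<open>\<psi>\<close> has been eliminated by the case \<open>z = 0\<close>. An entire
    \<open>G\<close> with \<open>exp (G w) = 1\<close> everywhere is constant, and
    \<open>G 1 = 0\<close>.\<close>
  define G where "G w = a * (B * w + \<phi> w - B - \<phi> 1 * w)" for w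
  have expG: "exp (G w) = 1" for w
  proof -
    have "exp (b * w + B * (a * w + b) - b * \<phi> w) * exp (b * \<phi> w + 1 * (a * \<phi> w + b)) =
       exp (b * 1 + B * (a * 1 + b) - b * \<phi> 1) * exp (b * w + \<phi> 1 * (a * w + b))"
      using eq[of w 1] p0 unfolding psi[of w] psi[of 1] by simp
    hence "exp (b * w + B * (a * w + b) - b * \<phi> w + (b * \<phi> w + 1 * (a * \<phi> w + b))) =
       exp (b * 1 + B * (a * 1 + b) - b * \<phi> 1 + (b * w + \<phi> 1 * (a * w + b)))"
      by (simp only: exp_add)
    hence "exp (b * w + B * (a * w + b) - b * \<phi> w + (b * \<phi> w + 1 * (a * \<phi> w + b)) -
       (b * 1 + B * (a * 1 + b) - b * \<phi> 1 + (b * w + \<phi> 1 * (a * w + b)))) = 1"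
      by (subst exp_diff) simp
    also have "b * w + B * (a * w + b) - b * \<phi> w + (b * \<phi> w + 1 * (a * \<phi> w + b)) -
       (b * 1 + B * (a * 1 + b) - b * \<phi> 1 + (b * w + \<phi> 1 * (a * w + b))) = G w"
      by (simp add: G_def algebra_simps)
    finally show ?thesis .
  qed
  have holG: "G holomorphic_on UNIV" unfolding G_def using hol by (auto intro!: holomorphic_intros)
  have "(G has_field_derivative 0) (at w)" for w
  proof -
    have d: "(G has_field_derivative deriv G w) (at w)"
      using holG by (simp add: holomorphic_derivI)
    have "((\<lambda>w. exp (G w)) has_field_derivative exp (G w) * deriv G w) (at w)"
      by (rule DERIV_fun_exp[OF d])
    hence "((\<lambda>_. 1) has_field_derivative deriv G w) (at w)" by (simp add: expG)
    hence "deriv G w = 0" using DERIV_unique DERIV_const by blast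
    with d show ?thesis by simp
  qed
  then obtain k where k: "\<And>w. G w = k"
    using has_field_derivative_zero_constant[of UNIV G] by auto
  have "G 1 = 0" by (simp add: G_def)
  hence "G w = 0" for w using k by metis
  hence G0: "B * w + \<phi> w - B - \<phi> 1 * w = 0" for w using a by (simp add: G_def)
  have phi: "\<phi> w = A * w + B" for w using G0[of w] unfolding A_def by algebra
  have "\<psi> w = \<psi> 0 * exp ((a * B - b * A + b) * w)" for w
  proof -
    have "b * w + B * (a * w + b) - b * \<phi> w = (a * B - b * A + b) * w"
      by (simp add: phi algebra_simps)
    thus ?thesis using psi[of w] by simp
  qed
  thus ?thesis using phi p0 by blast
qed

theorem theorem4p5:
  fixes \<psi> \<phi> :: "complex \<Rightarrow> complex" and W :: fock_op and a b c :: complex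
  assumes "\<psi> holomorphic_on UNIV" and "\<phi> holomorphic_on UNIV"
    and "\<exists>z. \<psi> z \<noteq> 0"
    and "wcomp_op \<psi> \<phi> W"
    and "cmod a = 1" and "cnj a * b + cnj b = 0"
    and "(cmod c)\<^sup>2 * exp ((cmod b)\<^sup>2) = 1"
  shows "C_selfadjoint (wcomp_conj a b c) W \<longleftrightarrow>
     W = wcomp_max \<psi> \<phi> \<and>
     (\<exists>A B C D. C \<noteq> 0 \<and> D = a * B - b * A + b \<and>
        (\<forall>z. \<phi> z = A * z + B) \<and> (\<forall>z. \<psi> z = C * exp (D * z)))"
proof
  let ?J = "wcomp_conj a b c" and ?T = "wcomp_max \<psi> \<phi>"
  note abc = assms(5-7)
  assume sa: "C_selfadjoint ?J W"
  obtain V where V: "V \<subseteq> dom ?T" and W: "W = ?T |` V"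
    using assms(4) by (auto simp: wcomp_op_def)
  have "a \<noteq> 0" using assms(5) by auto
  have "\<exists>A B C D. C \<noteq> 0 \<and> D = a * B - b * A + b \<and>
        (\<forall>z. \<phi> z = A * z + B) \<and> (\<forall>z. \<psi> z = C * exp (D * z))"
    by (rule wcomp_equation_solution[OF assms(2,3) \<open>a \<noteq> 0\<close> C_selfadjoint_wcomp_equation[OF abc sa W V]])
  then obtain A B C D where ABCD: "C \<noteq> 0" "D = a * B - b * A + b"
    "\<And>z. \<phi> z = A * z + B" "\<And>z. \<psi> z = C * exp (D * z)" by blast
  have dense: "densely_defined W" and self: "W = conj_by ?J (adjoint_op W)"
    using sa by (auto simp: C_selfadjoint_def)
  have domW: "dom W = V" using W V by auto
  have dom: "dom W \<subseteq> fock" using V by (auto simp: domW dom_wcomp_max)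
  \<comment> \<open>Maximality of the domain: the symmetry on the maximal domain, restricted to
    \<open>u\<close> in \<open>V\<close>, shows that \<open>?J f\<close> is in the domain of the
    adjoint of \<open>W\<close>, and selfadjointness brings \<open>f\<close> back into the domain of
    \<open>W\<close>.\<close>
  have "f \<in> V" if f: "f \<in> dom ?T" for f
  proof -
    have ff: "f \<in> fock" "wcomp_expr \<psi> \<phi> f \<in> fock" using f by (auto simp: dom_wcomp_max)
    have "adjoint_op W (?J f) = Some (?J (wcomp_expr \<psi> \<phi> f))"
      unfolding adjoint_op_Some_iff[OF dense dom]
    proof (intro conjI ballI)
      fix u assume "u \<in> dom W"
      hence u: "u \<in> V" "u \<in> dom ?T" using domW V by auto
      thus "fock_inner (the (W u)) (?J f) = fock_inner u (?J (wcomp_expr \<psi> \<phi> f))"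
        using wcomp_max_symmetric[OF abc ABCD u(2) f] by (simp add: W the_wcomp_max)
    qed (intro wcomp_conj_fock[OF abc] ff)+
    hence "W f \<noteq> None" by (subst self) (simp add: conj_by_def ff)
    thus ?thesis using domW by blast
  qed
  hence "V = dom ?T" using V by blast
  hence "W = ?T" by (auto simp: W restrict_map_def fun_eq_iff)
  thus "W = ?T \<and> (\<exists>A B C D. C \<noteq> 0 \<and> D = a * B - b * A + b \<and>
        (\<forall>z. \<phi> z = A * z + B) \<and> (\<forall>z. \<psi> z = C * exp (D * z)))"
    using ABCD by blast
next
  assume "W = wcomp_max \<psi> \<phi> \<and> (\<exists>A B C D. C \<noteq> 0 \<and> D = a * B - b * A + b \<and>
        (\<forall>z. \<phi> z = A * z + B) \<and> (\<forall>z. \<psi> z = C * exp (D * z)))"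
  thus "C_selfadjoint (wcomp_conj a b c) W"
    using wcomp_max_C_selfadjoint[OF assms(5-7)] by blast
qed

end
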